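(* Let $s \ge 0$ be an integer and $k = 4^{4^{2s^2}}$. Then, for each matroid $M$, either $M$ has a $U_{s,2s}$-minor, or $M$ has a minor isomorphic to the direct sum of $s$ copies of $U_{1,2}$, or there is a distance-$k$ perturbation of $M$ all of whose elements are loops or coloops.
   Context: An elementary projection of $M$ is a matroid obtained from an extension of $M$ by contracting the new element; an elementary lift of $M$ is one obtained from a coextension by deleting the new element. For matroids $M,N$ on the same ground set, $N$ is a distance-$k$ perturbation of $M$ if $N$ can be obtained from $M$ by a sequence of $k$ elementary lifts and elementary projections. *)

theory Defs
  imports Main
begin

record 'a indep_system =
  ground :: "'a set"
  indep :: "'a set set"

locale matroid =
  fixes M :: "'a indep_system"
  assumes finite_ground: "finite (ground M)"
    and indep_subset_ground: "X \<in> indep M \<Longrightarrow> X \<subseteq> ground M"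
    and indep_empty: "{} \<in> indep M"
    and indep_mono: "X \<in> indep M \<Longrightarrow> Y \<subseteq> X \<Longrightarrow> Y \<in> indep M"
    and augmentation: "X \<in> indep M \<Longrightarrow> Y \<in> indep M \<Longrightarrow> card X < card Y \<Longrightarrow>
      \<exists>e\<in>Y - X. insert e X \<in> indep M"

definition basis_in :: "'a indep_system \<Rightarrow> 'a set \<Rightarrow> 'a set \<Rightarrow> bool" where
  "basis_in M X B \<longleftrightarrow> B \<in> indep M \<and> B \<subseteq> X \<and>
     (\<forall>J\<in>indep M. B \<subseteq> J \<and> J \<subseteq> X \<longrightarrow> J = B)"

definition basis :: "'a indep_system \<Rightarrow> 'a set \<Rightarrow> bool" where
  "basis M B \<longleftrightarrow> basis_in M (ground M) B"

definition loop :: "'a indep_system \<Rightarrow> 'a \<Rightarrow> bool" where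
  "loop M e \<longleftrightarrow> e \<in> ground M \<and> {e} \<notin> indep M"

definition coloop :: "'a indep_system \<Rightarrow> 'a \<Rightarrow> bool" where
  "coloop M e \<longleftrightarrow> e \<in> ground M \<and> (\<forall>B. basis M B \<longrightarrow> e \<in> B)"

definition deletion :: "'a indep_system \<Rightarrow> 'a set \<Rightarrow> 'a indep_system" where
  "deletion M D = \<lparr>ground = ground M - D, indep = {X \<in> indep M. X \<inter> D = {}}\<rparr>"

definition contraction :: "'a indep_system \<Rightarrow> 'a set \<Rightarrow> 'a indep_system" where
  "contraction M C = \<lparr>ground = ground M - C,
     indep = {X. X \<subseteq> ground M - C \<and> (\<exists>B. basis_in M C B \<and> X \<union> B \<in> indep M)}\<rparr>"

definition isomorphic :: "'a indep_system \<Rightarrow> 'b indep_system \<Rightarrow> bool" where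
  "isomorphic M N \<longleftrightarrow> (\<exists>f. bij_betw f (ground M) (ground N) \<and>
     (\<forall>X. X \<subseteq> ground M \<longrightarrow> (X \<in> indep M \<longleftrightarrow> f ` X \<in> indep N)))"

definition has_minor :: "'a indep_system \<Rightarrow> 'b indep_system \<Rightarrow> bool" where
  "has_minor M N \<longleftrightarrow> (\<exists>C D. C \<subseteq> ground M \<and> D \<subseteq> ground M \<and> C \<inter> D = {} \<and>
     isomorphic (deletion (contraction M C) D) N)"

definition uniform :: "nat \<Rightarrow> nat \<Rightarrow> nat indep_system" where
  "uniform r n = \<lparr>ground = {..<n}, indep = {X. X \<subseteq> {..<n} \<and> card X \<le> r}\<rparr>"

definition direct_sum :: "'i set \<Rightarrow> ('i \<Rightarrow> 'a indep_system) \<Rightarrow> ('i \<times> 'a) indep_system" where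
  "direct_sum A N = \<lparr>ground = Sigma A (\<lambda>i. ground (N i)),
     indep = {X. X \<subseteq> Sigma A (\<lambda>i. ground (N i)) \<and> (\<forall>i\<in>A. {x. (i, x) \<in> X} \<in> indep (N i))}\<rparr>"

definition relabel :: "('a \<Rightarrow> 'b) \<Rightarrow> 'a indep_system \<Rightarrow> 'b indep_system" where
  "relabel f M = \<lparr>ground = f ` ground M, indep = (\<lambda>X. f ` X) ` indep M\<rparr>"

text \<open>Since the type \<^typ>\<open>'a\<close> need not contain an element outside the ground set, extensions and
  coextensions are taken over \<^typ>\<open>'a option\<close>: the original elements are tagged with
  \<^const>\<open>Some\<close> and the new element is \<^const>\<open>None\<close>.\<close>

definition extension :: "'a indep_system \<Rightarrow> 'a option indep_system \<Rightarrow> bool" where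
  "extension M P \<longleftrightarrow> matroid P \<and> None \<in> ground P \<and> deletion P {None} = relabel Some M"

definition coextension :: "'a indep_system \<Rightarrow> 'a option indep_system \<Rightarrow> bool" where
  "coextension M P \<longleftrightarrow> matroid P \<and> None \<in> ground P \<and> contraction P {None} = relabel Some M"

definition elementary_projection :: "'a indep_system \<Rightarrow> 'a indep_system \<Rightarrow> bool" where
  "elementary_projection M N \<longleftrightarrow> (\<exists>P. extension M P \<and> relabel Some N = contraction P {None})"

definition elementary_lift :: "'a indep_system \<Rightarrow> 'a indep_system \<Rightarrow> bool" where
  "elementary_lift M N \<longleftrightarrow> (\<exists>P. coextension M P \<and> relabel Some N = deletion P {None})"

definition perturbation :: "nat \<Rightarrow> 'a indep_system \<Rightarrow> 'a indep_system \<Rightarrow> bool" where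
  "perturbation k M N \<longleftrightarrow>
     ((\<lambda>M N. elementary_lift M N \<or> elementary_projection M N) ^^ k) M N"

end

(*
If B is a basis and D a maximal independent set in its complement, then making D loops and the
|D| elements of B that D replaces coloops turns M into loops and coloops in 2|D| elementary steps.
So assume |D| is large; contracting the rest of B gives a minor with two large disjoint bases A
and B.

Start with R = B and remove elements from R while A - D together with R still spans for every
small D. If this stops early, every b in R lies in a small cocircuit inside A + b, and choosing a
minimal cover by these cocircuits gives many disjoint two-element cocircuits, i.e. copies of
U_{1,2}. Otherwise one reaches N = M/R of rank s^3 on A in which all cocircuits are huge. If the
union U of the circuits of N of rank less than s has full rank, contracting hyperplanes of such
circuits produces skew parallel pairs one at a time; when no circuit is skew to the pairs found so
far, contracting the pairs lowers the rank of all remaining circuits, so this ends with s pairs.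
Otherwise A - U is huge, of bounded rank, and all its s-subsets are independent; a subset of it
that is dense in its rank contains U_{j,2j} with j >= s.
*)
theory Submission
  imports Defs
begin

text \<open>The constants are fixed from the end backwards. \<open>N\<close> faces two opposing
  demands: its rank must exceed \<open>s * (s - 1)\<^sup>2\<close>, so that sets of rank below
  \<open>s\<close> yield \<open>s\<close> skew pairs before the rank is used up, and it must be
  bounded in terms of \<open>s\<close>, since density forces a uniform restriction only relative to
  the rank. Rank \<open>s ^ 3\<close> meets both. In rank \<open>t\<close> the required density is
  \<open>4 ^ t\<^sup>2\<close>, so cocircuits of \<open>N\<close> need more than
  \<open>n = 4 ^ (s ^ 3)\<^sup>2\<close> elements. Reaching \<open>N\<close> takes
  \<open>s ^ 3\<close> removals from \<open>R\<close>. If no element can be removed, the argument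
  deletes \<open>s\<close> of the small cocircuits at once, so each removal costs a factor
  \<open>s\<close> in the meaning of "small"; hence two bases of size
  \<open>s ^ (s ^ 3) * n + s ^ 3\<close>. The perturbation spends two steps per element, and
  \<open>k\<close> is a round upper bound for the resulting number. Circuits need not stay circuits
  under contraction, so the argument runs on sets without coloops, a class that contraction
  preserves.\<close>

section \<open>Rank functions and skew parallel pairs\<close>

text \<open>Rank functions on all subsets of the type, without a ground set: contraction then needs no
  side conditions, and contracted elements simply become loops.\<close>

locale rank_fun =
  fixes r :: "'a set \<Rightarrow> nat"
  assumes rank_empty: "r {} = 0"
    and rank_mono: "X \<subseteq> Y \<Longrightarrow> r X \<le> r Y"
    and rank_insert_le: "r (insert x X) \<le> Suc (r X)"
    and rank_submod: "r (X \<union> Y) + r (X \<inter> Y) \<le> r X + r Y"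
begin

text \<open>Submodularity for \<open>B\<close> and \<open>A \<union> X\<close>, read as diminishing
  returns: the larger set gains no more from \<open>X\<close> than the smaller one. Sums replace
  differences because subtraction of naturals truncates. Most rank estimates below are
  instances.\<close>

lemma rank_Un_diff_le: "A \<subseteq> B \<Longrightarrow> r (B \<union> X) + r A \<le> r B + r (A \<union> X)"
proof -
  assume "A \<subseteq> B"
  then have "B \<union> (A \<union> X) = B \<union> X" "A \<subseteq> B \<inter> (A \<union> X)" by auto
  then show ?thesis using rank_submod[of B "A \<union> X"] rank_mono[of A "B \<inter> (A \<union> X)"] by simp
qed

lemma rank_Un_le_card: "finite X \<Longrightarrow> r (C \<union> X) \<le> r C + card X"
proof (induction X rule: finite_induct)
  case (insert x X)
  then show ?case using rank_insert_le[of x "C \<union> X"] by simp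
qed simp

lemma rank_le_card: "finite X \<Longrightarrow> r X \<le> card X"
  using rank_Un_le_card[of X "{}"] by (simp add: rank_empty)

lemma indep_over_subset:
  assumes "finite Y" "r (C \<union> Y) = r C + card Y" "Z \<subseteq> Y"
  shows "r (C \<union> Z) = r C + card Z"
proof -
  have "finite Z" using assms finite_subset by blast
  have "C \<union> Z \<union> (Y - Z) = C \<union> Y" using assms(3) by auto
  then have "r (C \<union> Y) \<le> r (C \<union> Z) + card (Y - Z)"
    using rank_Un_le_card[of "Y - Z" "C \<union> Z"] assms(1) by simp
  moreover have "card (Y - Z) + card Z = card Y"
    using assms(1,3) \<open>finite Z\<close> by (simp add: card_Diff_subset card_mono)
  ultimately show ?thesis
    using rank_Un_le_card[OF \<open>finite Z\<close>, of C] assms(2) by linarith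
qed

lemma indep_subset: "finite Y \<Longrightarrow> r Y = card Y \<Longrightarrow> Z \<subseteq> Y \<Longrightarrow> r Z = card Z"
  using indep_over_subset[of Y "{}" Z] by (simp add: rank_empty)

text \<open>Each \<open>X\<close> lies in the closure of \<open>C\<close>, and by diminishing
  returns so does the union. This stands in for a closure operator.\<close>

lemma rank_Un_Union_eq:
  assumes "finite F" "\<And>X. X \<in> F \<Longrightarrow> r (C \<union> X) = r C"
  shows "r (C \<union> \<Union>F) = r C"
  using assms
proof (induction F rule: finite_induct)
  case (insert X F)
  have "r ((C \<union> \<Union>F) \<union> X) + r C \<le> r (C \<union> \<Union>F) + r (C \<union> X)"
    by (rule rank_Un_diff_le) auto
  then have "r (C \<union> \<Union>(insert X F)) \<le> r C" using insert by (simp add: Un_ac)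
  moreover have "r C \<le> r (C \<union> \<Union>(insert X F))" by (rule rank_mono) auto
  ultimately show ?case by simp
qed simp

text \<open>An element that raises the rank on top of all others also raises it on top of fewer, so
  the elements of \<open>R\<close> can be added to \<open>G\<close> one by one with a gain of one
  each.\<close>

lemma coloops_indep:
  assumes "finite R" "\<And>b. b \<in> R \<Longrightarrow> r (G \<union> (R - {b})) < r (G \<union> R)"
  shows "r (G \<union> R) = r G + card R"
proof -
  have "r (G \<union> R') = r G + card R'" if "R' \<subseteq> R" for R'
    using finite_subset[OF that assms(1)] that
  proof (induction R' rule: finite_induct)
    case (insert b R')
    have "r ((G \<union> (R - {b})) \<union> {b}) + r (G \<union> R') \<le> r (G \<union> (R - {b})) + r ((G \<union> R') \<union> {b})"
      by (rule rank_Un_diff_le) (use insert in auto)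
    moreover have "(G \<union> (R - {b})) \<union> {b} = G \<union> R" using insert by auto
    ultimately have "r (G \<union> R') < r (G \<union> insert b R')"
      using assms(2)[of b] insert by simp
    then show ?case using rank_insert_le[of b "G \<union> R'"] insert by simp
  qed simp
  then show ?thesis by simp
qed

lemma rank_fun_contract: "rank_fun (\<lambda>X. r (X \<union> K) - r K)"
proof
  fix X Y x
  have mono: "r K \<le> r (Z \<union> K)" for Z by (rule rank_mono) auto
  show "r ({} \<union> K) - r K = 0" by simp
  show "X \<subseteq> Y \<Longrightarrow> r (X \<union> K) - r K \<le> r (Y \<union> K) - r K"
    by (intro diff_le_mono rank_mono) auto
  show "r (insert x X \<union> K) - r K \<le> Suc (r (X \<union> K) - r K)"
    using rank_insert_le[of x "X \<union> K"] by simp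
  have "r (X \<union> Y \<union> K) + r (X \<inter> Y \<union> K) \<le> r (X \<union> K) + r (Y \<union> K)"
  proof -
    have "(X \<union> K) \<union> (Y \<union> K) = X \<union> Y \<union> K" "(X \<union> K) \<inter> (Y \<union> K) = X \<inter> Y \<union> K" by auto
    then show ?thesis using rank_submod[of "X \<union> K" "Y \<union> K"] by simp
  qed
  then show "r (X \<union> Y \<union> K) - r K + (r (X \<inter> Y \<union> K) - r K)
      \<le> r (X \<union> K) - r K + (r (Y \<union> K) - r K)"
    using mono[of X] mono[of Y] mono[of "X \<union> Y"] mono[of "X \<inter> Y"] by linarith
qed

end

text \<open>\<^term>\<open>uniform_over r s C X\<close> and \<^term>\<open>parallel_pairs r C Q \<sigma>\<close> describe the two unavoidable minors as
  restrictions of the contraction by \<^term>\<open>C\<close>, the parallel pairs being \<^term>\<open>{q, \<sigma> q}\<close>.\<close>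

definition uniform_over :: "('a set \<Rightarrow> nat) \<Rightarrow> nat \<Rightarrow> 'a set \<Rightarrow> 'a set \<Rightarrow> bool" where
  "uniform_over r s C X \<longleftrightarrow> card X = 2 * s \<and> r (C \<union> X) = r C + s \<and>
     (\<forall>Z\<subseteq>X. card Z = s \<longrightarrow> r (C \<union> Z) = r C + s)"

definition parallel_pairs :: "('a set \<Rightarrow> nat) \<Rightarrow> 'a set \<Rightarrow> 'a set \<Rightarrow> ('a \<Rightarrow> 'a) \<Rightarrow> bool" where
  "parallel_pairs r C Q \<sigma> \<longleftrightarrow> finite Q \<and> r (C \<union> Q) = r C + card Q \<and>
     (\<forall>q\<in>Q. \<sigma> q \<noteq> q \<and> r (C \<union> {\<sigma> q}) = Suc (r C) \<and> r (C \<union> {q, \<sigma> q}) = Suc (r C))"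

text \<open>These are the finite sets that are unions of circuits. Unlike circuits, they keep their
  defining property over any contracted set, see \<open>coloop_free_over\<close>.\<close>

definition coloop_free :: "('a set \<Rightarrow> nat) \<Rightarrow> 'a set \<Rightarrow> bool" where
  "coloop_free r X \<longleftrightarrow> finite X \<and> (\<forall>x\<in>X. r (X - {x}) = r X)"

context rank_fun
begin

lemma uniform_over_contract:
  "uniform_over (\<lambda>X. r (X \<union> K) - r K) s C X \<Longrightarrow> uniform_over r s (C \<union> K) X"
proof -
  assume u: "uniform_over (\<lambda>X. r (X \<union> K) - r K) s C X"
  have "r (C \<union> K \<union> Z) = r (C \<union> K) + s" if "r (C \<union> Z \<union> K) - r K = r (C \<union> K) - r K + s" for Z
  proof -
    have "r K \<le> r (C \<union> K)" "r K \<le> r (C \<union> Z \<union> K)" by (rule rank_mono; auto)+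
    then show ?thesis using that by (simp add: Un_ac)
  qed
  then show ?thesis using u unfolding uniform_over_def by blast
qed

lemma parallel_pairs_contract:
  "parallel_pairs (\<lambda>X. r (X \<union> K) - r K) C Q \<sigma> \<Longrightarrow> parallel_pairs r (C \<union> K) Q \<sigma>"
proof -
  assume u: "parallel_pairs (\<lambda>X. r (X \<union> K) - r K) C Q \<sigma>"
  have *: "r (C \<union> K \<union> Z) = r (C \<union> K) + s" if "r (C \<union> Z \<union> K) - r K = r (C \<union> K) - r K + s" for Z s
  proof -
    have "r K \<le> r (C \<union> K)" "r K \<le> r (C \<union> Z \<union> K)" by (rule rank_mono; auto)+
    then show ?thesis using that by (simp add: Un_ac)
  qed
  have "r (C \<union> K \<union> Z) = Suc (r (C \<union> K))" if "r (C \<union> Z \<union> K) - r K = Suc (r (C \<union> K) - r K)" for Z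
    using *[of Z 1] that by simp
  then show ?thesis using u * unfolding parallel_pairs_def by blast
qed

lemma coloop_free_over:
  assumes "coloop_free r X" "x \<in> X"
  shows "r (C \<union> (X - {x})) = r (C \<union> X)"
proof -
  have eqs: "(C \<union> (X - {x})) \<union> {x} = C \<union> X" "(X - {x}) \<union> {x} = X" using assms(2) by auto
  have "r ((C \<union> (X - {x})) \<union> {x}) + r (X - {x}) \<le> r (C \<union> (X - {x})) + r ((X - {x}) \<union> {x})"
    by (rule rank_Un_diff_le) auto
  moreover have "r (X - {x}) = r X" using assms by (simp add: coloop_free_def)
  ultimately have "r (C \<union> X) \<le> r (C \<union> (X - {x}))" unfolding eqs by linarith
  moreover have "r (C \<union> (X - {x})) \<le> r (C \<union> X)" by (rule rank_mono) auto
  ultimately show ?thesis by simp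
qed

text \<open>A maximal \<open>Y\<close> that fails to span \<open>X\<close> over \<open>C\<close> is
  a hyperplane, so \<open>X - Y\<close> is a cocircuit. A single element there would be a coloop;
  hence there are two, and they become parallel once \<open>C \<union> Y\<close> is
  contracted.\<close>

lemma coloop_free_hyperplane:
  assumes "coloop_free r X" "r C < r (C \<union> X)"
  obtains Y x y where "Y \<subseteq> X" "x \<in> X - Y" "y \<in> X - Y" "x \<noteq> y"
    "Suc (r (C \<union> Y)) = r (C \<union> X)"
    "\<And>z. z \<in> X - Y \<Longrightarrow> r (C \<union> insert z Y) = r (C \<union> X)"
proof -
  have fin: "finite X" using assms by (simp add: coloop_free_def)
  define S where "S = {Y. Y \<subseteq> X \<and> r (C \<union> Y) < r (C \<union> X)}"
  have "{} \<in> S" using assms(2) by (simp add: S_def)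
  moreover have "finite S" using fin by (auto simp: S_def intro: finite_subset[of _ "Pow X"])
  ultimately obtain Y where YS: "Y \<in> S" and max: "\<And>Z. Z \<in> S \<Longrightarrow> Y \<subseteq> Z \<Longrightarrow> Y = Z"
    using finite_has_maximal2[of S "{}"] by metis
  have Y: "Y \<subseteq> X" "r (C \<union> Y) < r (C \<union> X)" using YS by (auto simp: S_def)
  have full: "r (C \<union> insert z Y) = r (C \<union> X)" if "z \<in> X - Y" for z
  proof -
    have "insert z Y \<notin> S" using max[of "insert z Y"] that by auto
    moreover have "insert z Y \<subseteq> X" using Y(1) that by blast
    moreover have "r (C \<union> insert z Y) \<le> r (C \<union> X)" by (rule rank_mono) (use Y(1) that in blast)
    ultimately show ?thesis by (simp add: S_def)
  qed
  have "Y \<noteq> X" using Y(2) by blast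
  then obtain x where x: "x \<in> X - Y" using Y(1) by blast
  have "r (C \<union> (X - {x})) = r (C \<union> X)" by (rule coloop_free_over) (use assms(1) x in blast)+
  then have "Y \<noteq> X - {x}" using Y(2) by (metis less_irrefl)
  then obtain y where y: "y \<in> X - Y" "x \<noteq> y" using Y(1) x by blast
  have "Suc (r (C \<union> Y)) = r (C \<union> X)"
    using full[OF x] rank_insert_le[of x "C \<union> Y"] Y(2) by simp
  then show ?thesis by (rule that[OF Y(1) x y(1) y(2) _ full])
qed

text \<open>Two elements outside a hyperplane \<open>Y\<close> of \<open>X\<close> become the new
  pair when \<open>Y\<close> is contracted, and skewness keeps it independent of the old pairs. The
  last conjunct states the price: one less than the rank of \<open>X\<close> over
  \<open>C\<close>.\<close>

lemma parallel_pairs_extend: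
  assumes pp: "parallel_pairs r C Q \<sigma>" and cf: "coloop_free r X"
    and nl: "r C < r (C \<union> X)" and skew: "r (C \<union> Q \<union> X) = r (C \<union> X) + card Q"
  shows "\<exists>C' Q' \<sigma>'. C \<subseteq> C' \<and> parallel_pairs r C' Q' \<sigma>' \<and> card Q' = Suc (card Q)
    \<and> Suc (r C') = r (C \<union> X)"
proof -
  obtain Y x y where Y: "Y \<subseteq> X" and x: "x \<in> X - Y" and y: "y \<in> X - Y" and xy: "x \<noteq> y"
    and rY: "Suc (r (C \<union> Y)) = r (C \<union> X)"
    and full: "\<And>z. z \<in> X - Y \<Longrightarrow> r (C \<union> insert z Y) = r (C \<union> X)"
    using coloop_free_hyperplane[OF cf nl] by metis
  have finQ: "finite Q" using pp by (simp add: parallel_pairs_def)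
  define C' where "C' = C \<union> Y"
  have rz: "r (C' \<union> {z}) = Suc (r C')" if "z \<in> X - Y" for z
    using full[OF that] rY by (simp add: C'_def)
  \<comment> \<open>\<open>X\<close> adds nothing to \<open>C' \<union> {x}\<close>, hence nothing
    to \<open>C' \<union> {x} \<union> Q\<close>, which therefore has the full rank of
    \<open>C \<union> Q \<union> X\<close>.\<close>
  have "r ((C' \<union> {x} \<union> Q) \<union> X) + r (C' \<union> {x}) \<le> r (C' \<union> {x} \<union> Q) + r ((C' \<union> {x}) \<union> X)"
    by (rule rank_Un_diff_le) auto
  moreover have "(C' \<union> {x} \<union> Q) \<union> X = C \<union> Q \<union> X" "(C' \<union> {x}) \<union> X = C \<union> X"
    using Y x by (auto simp: C'_def)
  ultimately have big: "r (C' \<union> {x} \<union> Q) \<ge> Suc (r C') + card Q"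
    using rz[OF x] rY skew by (simp add: C'_def)
  have xQ: "x \<notin> Q"
  proof
    assume "x \<in> Q"
    then have "C' \<union> {x} \<union> Q = C' \<union> Q" by auto
    then show False using big rank_Un_le_card[OF finQ, of C'] by simp
  qed
  have eqx: "C' \<union> insert x Q = C' \<union> {x} \<union> Q" by auto
  have rQ': "r (C' \<union> insert x Q) = r C' + card (insert x Q)"
    using big rank_Un_le_card[of "insert x Q" C'] finQ xQ unfolding eqx by simp
  have old: "\<sigma> q \<noteq> q \<and> r (C' \<union> {\<sigma> q}) = Suc (r C') \<and> r (C' \<union> {q, \<sigma> q}) = Suc (r C')"
    if q: "q \<in> Q" for q
  proof -
    have p: "\<sigma> q \<noteq> q" "r (C \<union> {\<sigma> q}) = Suc (r C)" "r (C \<union> {q, \<sigma> q}) = Suc (r C)"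
      using pp q by (auto simp: parallel_pairs_def)
    have "r (C' \<union> {q, \<sigma> q}) + r C \<le> r C' + r (C \<union> {q, \<sigma> q})"
      by (rule rank_Un_diff_le) (auto simp: C'_def)
    \<comment> \<open>\<open>q\<close> remains in the span of \<open>\<sigma> q\<close>, so
      \<open>\<sigma> q\<close> is still a nonloop because \<open>q\<close> is.\<close>
    moreover have "r ((C' \<union> {\<sigma> q}) \<union> {q}) + r (C \<union> {\<sigma> q}) \<le> r (C' \<union> {\<sigma> q}) + r ((C \<union> {\<sigma> q}) \<union> {q})"
      by (rule rank_Un_diff_le) (auto simp: C'_def)
    moreover have "r (C' \<union> {q}) = r C' + card {q}"
      by (rule indep_over_subset[OF _ rQ']) (use q finQ in auto)
    moreover have "r (C' \<union> {q}) \<le> r (C' \<union> {q, \<sigma> q})" by (rule rank_mono) auto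
    moreover have "r (C' \<union> {\<sigma> q}) \<le> r (C' \<union> {q, \<sigma> q})" by (rule rank_mono) auto
    ultimately show ?thesis using p by (simp add: insert_commute)
  qed
  have new: "r (C' \<union> {x, y}) = Suc (r C')"
  proof -
    have "r (C' \<union> {x, y}) \<le> r (C \<union> X)" by (rule rank_mono) (use Y x y in \<open>auto simp: C'_def\<close>)
    moreover have "r (C' \<union> {x}) \<le> r (C' \<union> {x, y})" by (rule rank_mono) auto
    ultimately show ?thesis using rz[OF x] rY by (simp add: C'_def)
  qed
  have "parallel_pairs r C' (insert x Q) (\<sigma>(x := y))"
    using rQ' old new rz[OF y] xy xQ finQ
    unfolding parallel_pairs_def by auto
  then show ?thesis using rY finQ xQ
    by (intro exI[of _ C'] exI[of _ "insert x Q"] exI[of _ "\<sigma>(x := y)"]) (auto simp: C'_def)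
qed

text \<open>Each round uses up at most \<^term>\<open>s * \<rho>\<close> of the rank and decreases the bound \<^term>\<open>\<rho>\<close> on the ranks
  of the members of \<^term>\<open>F\<close>; hence the threshold \<^term>\<open>s * \<rho>\<^sup>2\<close>.\<close>

lemma parallel_pairs_of_coloop_free:
  assumes fin: "finite F" and cf: "\<And>X. X \<in> F \<Longrightarrow> coloop_free r X"
  shows "(\<And>X. X \<in> F \<Longrightarrow> r (C \<union> X) \<le> r C + \<rho>) \<Longrightarrow> r C + s * \<rho>\<^sup>2 < r (C \<union> \<Union>F)
    \<Longrightarrow> \<exists>C Q \<sigma>. parallel_pairs r C Q \<sigma> \<and> card Q = s"
proof (induction \<rho> arbitrary: C)
  case 0
  have "r (C \<union> X) = r C" if "X \<in> F" for X
    using 0(1)[OF that] rank_mono[of C "C \<union> X"] by auto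
  then have "r (C \<union> \<Union>F) = r C" by (rule rank_Un_Union_eq[OF fin])
  then show ?case using 0(2) by simp
next
  case (Suc \<rho>)
  \<comment> \<open>Here \<open>n\<close> pairs are bought for at most \<open>\<rho>\<close> ranks
    each, the rank of a hyperplane in a set of rank \<open>Suc \<rho>\<close>.\<close>
  define P where "P n \<longleftrightarrow> n \<le> s \<and> (\<exists>C' Q \<sigma>. C \<subseteq> C' \<and> parallel_pairs r C' Q \<sigma> \<and> card Q = n \<and> r C' \<le> r C + n * \<rho>)" for n
  have "parallel_pairs r C {} id" by (simp add: parallel_pairs_def)
  then have "P 0" unfolding P_def by (intro conjI exI[of _ C] exI[of _ "{}"] exI[of _ id]) simp_all
  then obtain n where n: "P n" and max: "\<And>k. P k \<Longrightarrow> k \<le> n"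
    using GreatestI_nat[of P 0 s] Greatest_le_nat[of P _ s] P_def by metis
  obtain C' Q \<sigma> where C': "C \<subseteq> C'" and pp: "parallel_pairs r C' Q \<sigma>" and cQ: "card Q = n"
    and rC': "r C' \<le> r C + n * \<rho>" using n unfolding P_def by blast
  show ?case
  proof (cases "n = s")
    case True
    then show ?thesis using pp cQ by blast
  next
    case False
    then have ns: "n < s" using n by (simp add: P_def)
    define C1 where "C1 = C' \<union> Q"
    have rC1: "r C1 = r C' + n" using pp cQ by (simp add: parallel_pairs_def C1_def)
    have over: "r (C' \<union> X) \<le> r C' + Suc \<rho>" if "X \<in> F" for X
      using rank_Un_diff_le[OF C', of X] Suc.prems(1)[OF that] by simp
    \<comment> \<open>A set of rank above \<open>\<rho>\<close> over \<open>C1\<close> would have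
      the top rank \<open>Suc \<rho>\<close> over \<open>C'\<close> and be skew to \<open>Q\<close>,
      so it would supply one more pair.\<close>
    have step: "r (C1 \<union> X) \<le> r C1 + \<rho>" if X: "X \<in> F" for X
    proof (rule ccontr)
      assume neg: "\<not> r (C1 \<union> X) \<le> r C1 + \<rho>"
      have up: "r (C1 \<union> X) \<le> r (C' \<union> X) + n"
      proof -
        have "r ((C' \<union> X) \<union> Q) \<le> r (C' \<union> X) + card Q"
          using pp by (intro rank_Un_le_card) (simp add: parallel_pairs_def)
        then show ?thesis by (simp add: C1_def cQ Un_ac)
      qed
      have top: "r (C' \<union> X) = r C' + Suc \<rho>" using up neg rC1 over[OF X] by simp
      then have skew: "r (C' \<union> Q \<union> X) = r (C' \<union> X) + card Q"
        using up neg rC1 cQ by (simp add: C1_def)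
      obtain C2 Q2 \<sigma>2 where "C' \<subseteq> C2" "parallel_pairs r C2 Q2 \<sigma>2" "card Q2 = Suc n"
        "Suc (r C2) = r (C' \<union> X)"
        using parallel_pairs_extend[OF pp cf[OF X] _ skew] top cQ by auto
      then have "P (Suc n)" using ns C' rC' top
        unfolding P_def by (intro conjI exI[of _ C2] exI[of _ Q2] exI[of _ \<sigma>2]) auto
      then show False using max[of "Suc n"] by simp
    qed
    have "r (C \<union> \<Union>F) \<le> r (C1 \<union> \<Union>F)" by (rule rank_mono) (use C' in \<open>auto simp: C1_def\<close>)
    moreover have "r C1 \<le> r C + s * Suc \<rho>"
    proof -
      have "n * \<rho> + n \<le> s * Suc \<rho>" using ns mult_le_mono1[of n s "Suc \<rho>"] by simp
      then show ?thesis using rC1 rC' by simp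
    qed
    moreover have "s * Suc \<rho> + s * \<rho>\<^sup>2 \<le> s * (Suc \<rho>)\<^sup>2"
      by (simp add: power2_eq_square algebra_simps)
    ultimately have "r C1 + s * \<rho>\<^sup>2 < r (C1 \<union> \<Union>F)" using Suc.prems(2) by linarith
    then show ?thesis using Suc.IH[of C1] step by blast
  qed
qed

end

section \<open>Dense uniform restrictions\<close>

context rank_fun
begin

text \<open>A new element has to avoid the closures of all subsets of \<open>Y\<close> with at most
  \<open>t\<close> elements. There are at most \<open>2 ^ n\<close> of them, and each closure has
  rank at most \<open>t\<close>, hence fewer than \<open>4 ^ t\<^sup>2\<close> elements. They cannot
  cover \<open>V\<close> because
  \<open>2 ^ (2 * Suc t) * 4 ^ t\<^sup>2 \<le> 4 ^ (Suc t)\<^sup>2\<close>.\<close>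

lemma uniform_set_greedy:
  fixes t :: nat
  assumes finV: "finite V" and small: "\<And>W. W \<subseteq> V \<Longrightarrow> r W \<le> t \<Longrightarrow> card W < 4 ^ t\<^sup>2"
    and big: "4 ^ (Suc t)\<^sup>2 \<le> card V"
  shows "n \<le> 2 * Suc t \<Longrightarrow> \<exists>Y\<subseteq>V. card Y = n \<and> (\<forall>Z\<subseteq>Y. card Z \<le> Suc t \<longrightarrow> r Z = card Z)"
proof (induction n)
  case 0
  then show ?case by (intro exI[of _ "{}"]) (simp add: rank_empty)
next
  case (Suc n)
  then obtain Y where Y: "Y \<subseteq> V" "card Y = n"
    and ind: "\<And>Z. Z \<subseteq> Y \<Longrightarrow> card Z \<le> Suc t \<Longrightarrow> r Z = card Z" by auto
  have finY: "finite Y" using Y(1) finV by (rule finite_subset)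
  define cl where "cl Z = {v \<in> V. r (insert v Z) = r Z}" for Z
  define \<Z> where "\<Z> = {Z. Z \<subseteq> Y \<and> card Z \<le> t}"
  have cl: "card (cl Z) < 4 ^ t\<^sup>2" if "Z \<in> \<Z>" for Z
  proof (rule small)
    show "cl Z \<subseteq> V" by (auto simp: cl_def)
    have fin: "finite ((\<lambda>v. {v}) ` cl Z)" using finV by (simp add: cl_def)
    have "r (Z \<union> \<Union>((\<lambda>v. {v}) ` cl Z)) = r Z"
      by (rule rank_Un_Union_eq[OF fin]) (auto simp: cl_def)
    then have "r (cl Z) \<le> r Z" using rank_mono[of "cl Z" "Z \<union> \<Union>((\<lambda>v. {v}) ` cl Z)"] by auto
    then show "r (cl Z) \<le> t" using ind[of Z] that by (simp add: \<Z>_def)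
  qed
  have \<Z>: "finite \<Z>" "card \<Z> \<le> 2 ^ n"
  proof -
    have "\<Z> \<subseteq> Pow Y" by (auto simp: \<Z>_def)
    then show "finite \<Z>" "card \<Z> \<le> 2 ^ n"
      using finY Y(2) card_mono[of "Pow Y" \<Z>] by (auto simp: card_Pow intro: finite_subset)
  qed
  have "card (Y \<union> \<Union>(cl ` \<Z>)) \<le> card Y + card (\<Union>(cl ` \<Z>))" by (rule card_Un_le)
  also have "card (\<Union>(cl ` \<Z>)) \<le> (\<Sum>Z\<in>\<Z>. card (cl Z))" by (rule card_UN_le[OF \<Z>(1)])
  also have "\<dots> \<le> (\<Sum>Z\<in>\<Z>. 4 ^ t\<^sup>2)" by (rule sum_mono) (use cl in \<open>auto intro: less_imp_le\<close>)
  also have "\<dots> \<le> 2 ^ n * 4 ^ t\<^sup>2" using \<Z>(2) by simp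
  also have "card Y + 2 ^ n * 4 ^ t\<^sup>2 < 2 ^ n * (4 ^ t\<^sup>2 + 1)" using Y(2) by simp
  also have "\<dots> \<le> 2 ^ n * (2 * 4 ^ t\<^sup>2)" by (intro mult_left_mono) auto
  also have "\<dots> = 2 ^ Suc n * 4 ^ t\<^sup>2" by simp
  also have "\<dots> \<le> 2 ^ (2 * Suc t) * 4 ^ t\<^sup>2"
    using Suc.prems by (intro mult_right_mono power_increasing) auto
  also have "\<dots> = 4 ^ (Suc t + t\<^sup>2)" by (simp only: power_mult power_add) simp
  also have "\<dots> \<le> 4 ^ (Suc t)\<^sup>2"
    by (intro power_increasing) (auto simp: power2_eq_square)
  also have "\<dots> \<le> card V" by (rule big)
  finally have "card (Y \<union> \<Union>(cl ` \<Z>)) < card V" by simp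
  then have "\<not> V \<subseteq> Y \<union> \<Union>(cl ` \<Z>)"
    using card_mono[of "Y \<union> \<Union>(cl ` \<Z>)" V] finY \<Z>(1) finV by (auto simp: cl_def)
  then obtain v where v: "v \<in> V" "v \<notin> Y" "\<And>Z. Z \<in> \<Z> \<Longrightarrow> v \<notin> cl Z" by blast
  show ?case
  proof (intro exI conjI allI impI)
    show "insert v Y \<subseteq> V" "card (insert v Y) = Suc n" using v Y finY by auto
    fix Z assume Z: "Z \<subseteq> insert v Y" "card Z \<le> Suc t"
    show "r Z = card Z"
    proof (cases "v \<in> Z")
      case False
      then show ?thesis using ind[of Z] Z by auto
    next
      case True
      define Z' where "Z' = Z - {v}"
      have Z': "Z = insert v Z'" "v \<notin> Z'" "Z' \<subseteq> Y" "finite Z'"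
        using True Z finY by (auto simp: Z'_def intro: finite_subset)
      then have "Z' \<in> \<Z>" using Z(2) by (simp add: \<Z>_def)
      then have "r (insert v Z') \<noteq> r Z'" using v(1) v(3)[of Z'] by (auto simp: cl_def)
      then have "r (insert v Z') = Suc (r Z')"
        using rank_insert_le[of v Z'] rank_mono[OF subset_insertI, of Z' v]
        by linarith
      moreover have "r Z' = card Z'" using ind[of Z'] Z' Z(2) by simp
      ultimately show ?thesis using Z' by simp
    qed
  qed
qed

text \<open>Induction on the rank bound: either some subset of rank at most \<open>t\<close> is
  dense enough for \<open>t\<close>, or all such subsets are small and the greedy choice succeeds
  with \<open>j = Suc t\<close>.\<close>

lemma uniform_subset_exists:
  assumes "1 \<le> s" "finite V" "\<And>Z. Z \<subseteq> V \<Longrightarrow> card Z \<le> s \<Longrightarrow> r Z = card Z"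
    "r V \<le> t" "4 ^ t\<^sup>2 \<le> card V"
  shows "\<exists>X j. X \<subseteq> V \<and> s \<le> j \<and> card X = 2 * j \<and> r X = j \<and> (\<forall>Z\<subseteq>X. card Z = j \<longrightarrow> r Z = j)"
  using assms
proof (induction t arbitrary: V)
  case 0
  have "V \<noteq> {}" using 0(5) by auto
  then obtain v where "v \<in> V" by blast
  then have "r {v} = 1" using 0(1) 0(3)[of "{v}"] by simp
  then show ?case using rank_mono[of "{v}" V] \<open>v \<in> V\<close> 0(4) by simp
next
  case (Suc t)
  show ?case
  proof (cases "\<exists>W\<subseteq>V. r W \<le> t \<and> 4 ^ t\<^sup>2 \<le> card W")
    case True
    then obtain W where W: "W \<subseteq> V" "r W \<le> t" "4 ^ t\<^sup>2 \<le> card W" by blast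
    have "\<exists>X j. X \<subseteq> W \<and> s \<le> j \<and> card X = 2 * j \<and> r X = j \<and> (\<forall>Z\<subseteq>X. card Z = j \<longrightarrow> r Z = j)"
    proof (rule Suc.IH[OF Suc.prems(1) _ _ W(2,3)])
      show "finite W" using W(1) Suc.prems(2) by (rule finite_subset)
      show "r Z = card Z" if "Z \<subseteq> W" "card Z \<le> s" for Z
        by (rule Suc.prems(3)[OF subset_trans[OF that(1) W(1)] that(2)])
    qed
    then show ?thesis using W(1) by (meson subset_trans)
  next
    case False
    then have "card W < 4 ^ t\<^sup>2" if "W \<subseteq> V" "r W \<le> t" for W using that by (meson not_less)
    then have "\<exists>Y\<subseteq>V. card Y = 2 * Suc t \<and> (\<forall>Z\<subseteq>Y. card Z \<le> Suc t \<longrightarrow> r Z = card Z)"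
      by (intro uniform_set_greedy[OF Suc.prems(2) _ Suc.prems(5) order_refl])
    then obtain Y where Y: "Y \<subseteq> V" "card Y = 2 * Suc t"
      "\<And>Z. Z \<subseteq> Y \<Longrightarrow> card Z \<le> Suc t \<Longrightarrow> r Z = card Z" by blast
    have top: "r Z \<le> Suc t" if "Z \<subseteq> Y" for Z
      using rank_mono[OF subset_trans[OF that Y(1)]] Suc.prems(4) by linarith
    \<comment> \<open>Otherwise \<open>Suc (Suc t)\<close> elements would be independent inside a
      set of rank at most \<open>Suc t\<close>.\<close>
    have "s \<le> Suc t"
    proof (rule ccontr)
      assume "\<not> s \<le> Suc t"
      moreover obtain Z where "Z \<subseteq> Y" "card Z = Suc (Suc t)"
        using obtain_subset_with_card_n[of "Suc (Suc t)" Y] Y(2) by auto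
      ultimately show False using Suc.prems(3)[of Z] top[of Z] Y(1) by auto
    qed
    moreover have "r Y = Suc t"
    proof -
      obtain Z where "Z \<subseteq> Y" "card Z = Suc t"
        using obtain_subset_with_card_n[of "Suc t" Y] Y(2) by auto
      then show ?thesis using Y(3)[of Z] top[of Y] rank_mono[of Z Y] by auto
    qed
    ultimately show ?thesis using Y by (intro exI[of _ Y] exI[of _ "Suc t"]) auto
  qed
qed

text \<open>Contracting \<open>j - s\<close> elements of \<open>U_{j,2j}\<close> leaves
  \<open>U_{s,j+s}\<close>, which has at least \<open>2 * s\<close> elements because
  \<open>s \<le> j\<close>.\<close>

lemma uniform_over_exists:
  assumes s: "1 \<le> s" and V: "finite V" "\<And>Z. Z \<subseteq> V \<Longrightarrow> card Z \<le> s \<Longrightarrow> r Z = card Z"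
    "r V \<le> t" "4 ^ t\<^sup>2 \<le> card V"
  shows "\<exists>C X. uniform_over r s C X"
proof -
  obtain X j where X: "s \<le> j" "card X = 2 * j" "r X = j"
    "\<And>Z. Z \<subseteq> X \<Longrightarrow> card Z = j \<Longrightarrow> r Z = j"
    using uniform_subset_exists[OF s V] by metis
  have finX: "finite X" using X(1,2) s by (intro card_ge_0_finite) simp
  have "j - s \<le> card X" using X(2) by simp
  then obtain C where C: "C \<subseteq> X" "card C = j - s"
    using obtain_subset_with_card_n[of "j - s" X] by blast
  have finC: "finite C" using C(1) finX by (rule finite_subset)
  have "card (X - C) = j + s" using C X finC by (simp add: card_Diff_subset)
  then obtain X' where X': "X' \<subseteq> X - C" "card X' = 2 * s"
    using obtain_subset_with_card_n[of "2 * s" "X - C"] X(1) by auto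
  have base: "r (C \<union> Z) = j" if "Z \<subseteq> X'" "card Z = s" for Z
  proof (rule X(4))
    show "C \<union> Z \<subseteq> X" using C X' that by auto
    have "finite Z" using finX X' that by (meson finite_Diff finite_subset)
    then have "card (C \<union> Z) = card C + card Z"
      using finC X' that by (intro card_Un_disjoint) auto
    then show "card (C \<union> Z) = j" using C that X(1) by simp
  qed
  obtain Z where Z: "Z \<subseteq> X'" "card Z = s"
    using obtain_subset_with_card_n[of s X'] X'(2) by auto
  have finZ: "finite Z" using Z(2) s by (intro card_ge_0_finite) simp
  have rC: "r C = j - s"
    using rank_le_card[OF finC] C(2) base[OF Z] rank_Un_le_card[OF finZ, of C] Z(2) by simp
  have "C \<union> X' \<subseteq> X" "C \<union> Z \<subseteq> C \<union> X'" using C(1) X'(1) Z(1) by auto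
  then have "r (C \<union> X') = j"
    using rank_mono[of "C \<union> X'" X] rank_mono[of "C \<union> Z" "C \<union> X'"] base[OF Z] X(3) by simp
  then have "uniform_over r s C X'"
    using base rC X(1) X'(2) by (simp add: uniform_over_def)
  then show ?thesis by blast
qed

end

section \<open>Two disjoint bases\<close>

text \<open>In a cover of least cardinality no member is redundant, so each has an element that no
  other member contains; and covering \<open>s * d\<close> points by sets of size at most
  \<open>d\<close> takes at least \<open>s\<close> of them.\<close>

lemma private_elements:
  fixes D :: "'b \<Rightarrow> 'a set"
  assumes fin: "finite R" and D: "\<And>b. b \<in> R \<Longrightarrow> finite (D b) \<and> card (D b) \<le> d"
    and big: "s * d \<le> card (\<Union>(D ` R))" and d: "1 \<le> d"
  shows "\<exists>Q \<sigma>. Q \<subseteq> R \<and> card Q = s \<and>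
    (\<forall>b\<in>Q. \<sigma> b \<in> D b \<and> (\<forall>c\<in>Q. c \<noteq> b \<longrightarrow> \<sigma> b \<notin> D c))"
proof -
  let ?cover = "\<lambda>B. B \<subseteq> R \<and> \<Union>(D ` B) = \<Union>(D ` R)"
  define n where "n = (LEAST n. \<exists>B. ?cover B \<and> card B = n)"
  have ex: "\<exists>n B. ?cover B \<and> card B = n" by blast
  have "\<exists>B. ?cover B \<and> card B = n" unfolding n_def by (rule LeastI_ex[OF ex])
  then obtain B where B: "B \<subseteq> R" "\<Union>(D ` B) = \<Union>(D ` R)" "card B = n" by blast
  have min: "n \<le> card B'" if "?cover B'" for B' unfolding n_def by (rule Least_le) (use that in blast)
  have finB: "finite B" using B(1) fin by (rule finite_subset)
  have "card (\<Union>(D ` B)) \<le> (\<Sum>b\<in>B. card (D b))" by (rule card_UN_le[OF finB])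
  also have "\<dots> \<le> (\<Sum>b\<in>B. d)" by (rule sum_mono) (use D B in auto)
  finally have "card (\<Union>(D ` R)) \<le> card B * d" using B(2) by simp
  with big have "s * d \<le> card B * d" by (rule le_trans)
  then have "s \<le> card B" using d by simp
  then obtain Q where Q: "Q \<subseteq> B" "card Q = s" using obtain_subset_with_card_n by metis
  have "\<exists>a\<in>D b. \<forall>c\<in>B. c \<noteq> b \<longrightarrow> a \<notin> D c" if b: "b \<in> B" for b
  proof (rule ccontr)
    assume "\<not> ?thesis"
    then have "\<Union>(D ` (B - {b})) = \<Union>(D ` B)" by blast
    then have "?cover (B - {b})" using B by auto
    then have "n \<le> card (B - {b})" by (rule min)
    then show False using B(3) finB b by (metis card_Diff1_less leD)
  qed
  then obtain \<sigma> where "\<And>b. b \<in> B \<Longrightarrow> \<sigma> b \<in> D b \<and> (\<forall>c\<in>B. c \<noteq> b \<longrightarrow> \<sigma> b \<notin> D c)" by metis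
  then show ?thesis using Q B(1) by (intro exI[of _ Q] exI[of _ \<sigma>]) blast
qed

section \<open>Removing elements from the second basis\<close>

context rank_fun
begin

text \<open>For \<open>R\<close> disjoint from \<open>A\<close> and
  \<open>r (A \<union> R) = card A\<close>: every cocircuit of the restriction to
  \<open>A \<union> R\<close> that avoids \<open>R\<close> has more than \<open>d\<close> elements.
  These are the cocircuits that survive contracting \<open>R\<close>.\<close>

definition robust :: "'a set \<Rightarrow> nat \<Rightarrow> 'a set \<Rightarrow> bool" where
  "robust A d R \<longleftrightarrow> (\<forall>D\<subseteq>A. card D \<le> d \<longrightarrow> card A \<le> r ((A - D) \<union> R))"

text \<open>For positive \<open>s\<close>, a minimal \<open>D b\<close> is the trace on
  \<open>A\<close> of a small cocircuit through \<open>b\<close>. Robustness enters twice: it makes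
  the union \<open>U\<close> of these traces large, and it lets the \<open>s\<close> selected ones
  be deleted together at full rank.\<close>

lemma parallel_pairs_of_sparse:
  assumes A: "finite A" "r A = card A" and R: "finite R" "A \<inter> R = {}" and top: "r (A \<union> R) = card A"
    and rob: "robust A d R" and d: "s * d' \<le> d" "1 \<le> d'" "s * d' \<le> card R"
    and sparse: "\<And>b. b \<in> R \<Longrightarrow> \<exists>D\<subseteq>A. card D \<le> d' \<and> r ((A - D) \<union> (R - {b})) < card A"
  shows "\<exists>C Q \<sigma>. parallel_pairs r C Q \<sigma> \<and> card Q = s"
proof -
  define m where "m = card A"
  have le_m: "r X \<le> m" if "X \<subseteq> A \<union> R" for X
    using rank_mono[OF that] top by (simp add: m_def)
  have rob_eq: "r ((A - D) \<union> R) = m" if "D \<subseteq> A" "card D \<le> d" for D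
  proof (rule order_antisym)
    show "r ((A - D) \<union> R) \<le> m" by (rule le_m) auto
    show "m \<le> r ((A - D) \<union> R)" using rob that unfolding robust_def m_def by simp
  qed
  have "\<exists>D. D \<subseteq> A \<and> card D \<le> d' \<and> r ((A - D) \<union> (R - {b})) < m \<and>
      (\<forall>a\<in>D. r ((A - (D - {a})) \<union> (R - {b})) = m)" if b: "b \<in> R" for b
  proof -
    define S where "S = {D. D \<subseteq> A \<and> card D \<le> d' \<and> r ((A - D) \<union> (R - {b})) < m}"
    obtain D0 where D0: "D0 \<in> S" using sparse[OF b] by (auto simp: S_def m_def)
    have "finite S" using A(1) by (auto simp: S_def intro: finite_subset[of _ "Pow A"])
    then obtain D where DS: "D \<in> S" and min: "\<And>D'. D' \<in> S \<Longrightarrow> D' \<subseteq> D \<Longrightarrow> D = D'"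
      using finite_has_minimal2[of S D0] D0 by metis
    have D: "D \<subseteq> A" "card D \<le> d'" "r ((A - D) \<union> (R - {b})) < m"
      using DS by (auto simp: S_def)
    have finD: "finite D" using D(1) A(1) by (rule finite_subset)
    have "r ((A - (D - {a})) \<union> (R - {b})) = m" if a: "a \<in> D" for a
    proof -
      have "D - {a} \<notin> S" using min[of "D - {a}"] a by auto
      moreover have "card (D - {a}) \<le> d'" using D(2) card_Diff1_le[of D a] by simp
      ultimately have "\<not> r ((A - (D - {a})) \<union> (R - {b})) < m" using D(1) by (auto simp: S_def)
      moreover have "r ((A - (D - {a})) \<union> (R - {b})) \<le> m" by (rule le_m) auto
      ultimately show ?thesis by simp
    qed
    then show ?thesis by (intro exI[of _ D] conjI ballI D)
  qed
  then obtain D where D: "\<And>b. b \<in> R \<Longrightarrow> D b \<subseteq> A" "\<And>b. b \<in> R \<Longrightarrow> card (D b) \<le> d'"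
    "\<And>b. b \<in> R \<Longrightarrow> r ((A - D b) \<union> (R - {b})) < m"
    "\<And>b a. b \<in> R \<Longrightarrow> a \<in> D b \<Longrightarrow> r ((A - (D b - {a})) \<union> (R - {b})) = m"
    by metis
  have finD: "finite (D b)" if "b \<in> R" for b using D(1)[OF that] A(1) by (rule finite_subset)
  define U where "U = \<Union>(D ` R)"
  have UA: "U \<subseteq> A" using D(1) by (auto simp: U_def)
  have finU: "finite U" using UA A(1) by (rule finite_subset)
  \<comment> \<open>A small \<open>U\<close> could be deleted without loss of rank, yet every
    \<open>b\<close> would be a coloop over \<open>A - U\<close>; counting ranks then gives
    \<open>card R \<le> card U\<close>.\<close>
  have "s * d' \<le> card U"
  proof (rule ccontr)
    assume "\<not> s * d' \<le> card U"
    then have full: "r ((A - U) \<union> R) = m" by (intro rob_eq[OF UA]) (use d(1) in simp)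
    have "r ((A - U) \<union> R) = r (A - U) + card R"
    proof (rule coloops_indep[OF R(1)])
      fix b assume b: "b \<in> R"
      have "r ((A - U) \<union> (R - {b})) \<le> r ((A - D b) \<union> (R - {b}))"
        by (rule rank_mono) (use b in \<open>auto simp: U_def\<close>)
      then show "r ((A - U) \<union> (R - {b})) < r ((A - U) \<union> R)" using D(3)[OF b] full by linarith
    qed
    moreover have "r (A - U) = card (A - U)" using indep_subset[OF A] by blast
    moreover have "card (A - U) + card U = m"
      using UA finU A(1) by (simp add: card_Diff_subset card_mono m_def)
    ultimately have "card R \<le> card U" using full by linarith
    then show False using d(3) \<open>\<not> s * d' \<le> card U\<close> by simp
  qed
  then have "\<exists>Q \<sigma>. Q \<subseteq> R \<and> card Q = s \<and> (\<forall>b\<in>Q. \<sigma> b \<in> D b \<and> (\<forall>c\<in>Q. c \<noteq> b \<longrightarrow> \<sigma> b \<notin> D c))"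
    by (intro private_elements[OF R(1) _ _ d(2)]) (auto simp: U_def intro: finD D(2))
  then obtain Q \<sigma> where Q: "Q \<subseteq> R" "card Q = s" "\<And>b. b \<in> Q \<Longrightarrow> \<sigma> b \<in> D b"
    "\<And>b c. b \<in> Q \<Longrightarrow> c \<in> Q \<Longrightarrow> c \<noteq> b \<Longrightarrow> \<sigma> b \<notin> D c"
    by metis
  have finQ: "finite Q" using Q(1) R(1) by (rule finite_subset)
  define W where "W = \<Union>(D ` Q)"
  define C where "C = (A - W) \<union> (R - Q)"
  have WA: "W \<subseteq> A" using D(1) Q(1) by (auto simp: W_def)
  have "card W \<le> (\<Sum>b\<in>Q. card (D b))" unfolding W_def by (rule card_UN_le[OF finQ])
  also have "\<dots> \<le> (\<Sum>b\<in>Q. d')" by (rule sum_mono) (use D(2) Q(1) in auto)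
  finally have "card W \<le> d" using Q(2) d(1) by simp
  then have full: "r ((A - W) \<union> R) = m" by (rule rob_eq[OF WA])
  have CQ: "C \<union> Q = (A - W) \<union> R" using Q(1) by (auto simp: C_def)
  have hyp: "r (C \<union> X) < m" if "b \<in> Q" "X \<subseteq> (A - D b) \<union> (R - {b})" for b X
  proof -
    have "r (C \<union> X) \<le> r ((A - D b) \<union> (R - {b}))"
      by (rule rank_mono) (use that in \<open>auto simp: C_def W_def\<close>)
    also have "\<dots> < m" by (rule D(3)) (use that Q(1) in auto)
    finally show ?thesis .
  qed
  have rCQ: "r (C \<union> Q) = r C + card Q"
  proof (rule coloops_indep[OF finQ])
    fix b assume b: "b \<in> Q"
    have "r (C \<union> (Q - {b})) < m" by (rule hyp[OF b]) (use Q(1) in auto)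
    then show "r (C \<union> (Q - {b})) < r (C \<union> Q)" unfolding CQ full .
  qed
  have pairs: "\<sigma> q \<noteq> q \<and> r (C \<union> {\<sigma> q}) = Suc (r C) \<and> r (C \<union> {q, \<sigma> q}) = Suc (r C)" if q: "q \<in> Q" for q
  proof -
    have qR: "q \<in> R" using q Q(1) by auto
    have \<sigma>: "\<sigma> q \<in> D q" "\<sigma> q \<in> A" using Q(3)[OF q] D(1)[OF qR] by auto
    have ne: "\<sigma> q \<noteq> q" using \<sigma> qR R(2) by auto
    let ?H = "(A - D q) \<union> (R - {q})"
    have "r (?H \<union> {\<sigma> q}) + r C \<le> r ?H + r (C \<union> {\<sigma> q})"
      by (rule rank_Un_diff_le) (use q in \<open>auto simp: C_def W_def\<close>)
    moreover have H: "?H \<union> {\<sigma> q} = (A - (D q - {\<sigma> q})) \<union> (R - {q})" using \<sigma> by auto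
    have "r (?H \<union> {\<sigma> q}) = m" unfolding H by (rule D(4)[OF qR \<sigma>(1)])
    ultimately have nl: "r C < r (C \<union> {\<sigma> q})" using D(3)[OF qR] by linarith
    let ?G = "C \<union> {q, \<sigma> q}"
    have "?G \<union> (Q - {q}) = C \<union> Q \<union> {\<sigma> q}" using q by auto
    moreover have "r (C \<union> Q \<union> {\<sigma> q}) = m"
    proof -
      have "r (C \<union> Q \<union> {\<sigma> q}) \<le> m" by (rule le_m) (use \<sigma> CQ in auto)
      moreover have "r (C \<union> Q) \<le> r (C \<union> Q \<union> {\<sigma> q})" by (rule rank_mono) auto
      ultimately show ?thesis unfolding CQ full by (rule order_antisym)
    qed
    ultimately have fullG: "r (?G \<union> (Q - {q})) = m" by simp
    \<comment> \<open>The other members \<open>b\<close> of \<open>Q\<close> remain coloops over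
      \<open>?G\<close> since \<open>\<sigma> q\<close> lies in no other \<open>D b\<close>. This
      leaves rank one for \<open>{q, \<sigma> q}\<close> over \<open>C\<close>.\<close>
    have "r (?G \<union> (Q - {q})) = r ?G + card (Q - {q})"
    proof (rule coloops_indep)
      fix b assume b: "b \<in> Q - {q}"
      have "r (C \<union> ({q, \<sigma> q} \<union> (Q - {q} - {b}))) < m"
        by (rule hyp[of b]) (use b q qR \<sigma> Q(1) Q(4)[of q b] R(2) in auto)
      then show "r (?G \<union> (Q - {q} - {b})) < r (?G \<union> (Q - {q}))" using fullG by (simp add: Un_assoc)
    qed (use finQ in simp)
    moreover have "Suc (card (Q - {q})) = card Q" using finQ q by (rule card_Suc_Diff1)
    ultimately have "r ?G = Suc (r C)" using fullG full rCQ unfolding CQ by linarith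
    moreover have "r (C \<union> {\<sigma> q}) = Suc (r C)" using nl rank_insert_le[of "\<sigma> q" C] by simp
    ultimately show ?thesis using ne by simp
  qed
  then have "parallel_pairs r C Q \<sigma>" using finQ rCQ by (simp add: parallel_pairs_def)
  then show ?thesis using Q(2) by blast
qed

text \<open>\<open>B\<close> alone spans, so the start is robust for every bound. If no element of
  \<open>R\<close> can be removed at the next bound, \<open>parallel_pairs_of_sparse\<close>
  applies: it asks for robustness \<open>s\<close> times that bound, which is what \<open>R\<close>
  has. The hypothesis \<open>big\<close> keeps \<open>R\<close> large enough throughout.\<close>

lemma robust_subset_or_parallel_pairs:
  assumes A: "finite A" "r A = card A" and B: "finite B" "A \<inter> B = {}" "r B = card A" "card B = card A"
    and top: "r (A \<union> B) = card A" and s: "1 \<le> s" and n: "1 \<le> n"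
    and big: "s ^ T * n + T \<le> card A"
  shows "t \<le> T \<Longrightarrow> (\<exists>C Q \<sigma>. parallel_pairs r C Q \<sigma> \<and> card Q = s) \<or>
    (\<exists>R\<subseteq>B. card R + t = card A \<and> robust A (s ^ (T - t) * n) R)"
proof (induction t)
  case 0
  have "card A \<le> r ((A - D) \<union> B)" for D using rank_mono[of B "(A - D) \<union> B"] B(3) by auto
  then show ?case using B(4) by (auto simp: robust_def)
next
  case (Suc t)
  show ?case
  proof (cases "\<exists>C Q \<sigma>. parallel_pairs r C Q \<sigma> \<and> card Q = s")
    case False
    then obtain R where R: "R \<subseteq> B" "card R + t = card A" "robust A (s ^ (T - t) * n) R"
      using Suc by auto
    have finR: "finite R" using R(1) B(1) by (rule finite_subset)
    define d where "d = s ^ (T - Suc t) * n"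
    have sd: "s * d = s ^ (T - t) * n"
      using Suc.prems by (simp add: d_def Suc_diff_Suc flip: power_Suc mult.assoc)
    have d: "1 \<le> d" using s n by (simp add: d_def)
    have "s ^ (T - t) \<le> s ^ T" using s by (intro power_increasing) auto
    then have "s ^ (T - t) * n \<le> s ^ T * n" by (rule mult_le_mono1)
    then have sdR: "s * d \<le> card R" unfolding sd using big R(2) Suc.prems by linarith
    have topR: "r (A \<union> R) = card A"
      using rank_mono[of A "A \<union> R"] rank_mono[of "A \<union> R" "A \<union> B"] R(1) A(2) top by auto
    have "\<not> (\<forall>b\<in>R. \<exists>D\<subseteq>A. card D \<le> d \<and> r ((A - D) \<union> (R - {b})) < card A)"
    proof
      assume *: "\<forall>b\<in>R. \<exists>D\<subseteq>A. card D \<le> d \<and> r ((A - D) \<union> (R - {b})) < card A"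
      have "A \<inter> R = {}" using R(1) B(2) by auto
      then have "\<exists>C Q \<sigma>. parallel_pairs r C Q \<sigma> \<and> card Q = s"
        using * by (intro parallel_pairs_of_sparse[OF A finR _ topR R(3) eq_refl[OF sd] d sdR]) auto
      with False show False by (rule notE)
    qed
    then obtain b where b: "b \<in> R" "robust A d (R - {b})" by (auto simp: robust_def not_less)
    have "card (R - {b}) + Suc t = card A" using b(1) finR R(2) card_Suc_Diff1[of R b] by simp
    then have "\<exists>R\<subseteq>B. card R + Suc t = card A \<and> robust A d R"
      using b(2) R(1) by (intro exI[of _ "R - {b}"]) auto
    then show ?thesis by (simp add: d_def)
  qed simp
qed

section \<open>The contracted matroid of rank \<open>s ^ 3\<close>\<close>

lemma circuit_exists:
  assumes "finite Z" "r Z \<noteq> card Z"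
  shows "\<exists>X\<subseteq>Z. X \<noteq> {} \<and> coloop_free r X \<and> r X < card X"
  using assms
proof (induction "card Z" arbitrary: Z rule: less_induct)
  case less
  have Z: "r Z < card Z" using rank_le_card[OF less.prems(1)] less.prems(2) by simp
  show ?case
  proof (cases "\<exists>x\<in>Z. r (Z - {x}) \<noteq> card (Z - {x})")
    case True
    then obtain x where "x \<in> Z" "r (Z - {x}) \<noteq> card (Z - {x})" by blast
    then have "\<exists>X\<subseteq>Z - {x}. X \<noteq> {} \<and> coloop_free r X \<and> r X < card X"
      using less.hyps[of "Z - {x}"] less.prems(1) card_Diff1_less[of Z x] by blast
    then show ?thesis by blast
  next
    case False
    have "r (Z - {x}) = r Z" if "x \<in> Z" for x
      using False that Z rank_mono[of "Z - {x}" Z] card_Suc_Diff1[OF less.prems(1) that] by auto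
    then show ?thesis using Z less.prems(1) by (auto simp: coloop_free_def intro!: exI[of _ Z])
  qed
qed

text \<open>Full rank of \<open>U\<close> exceeds the threshold \<open>s * (s - 1)\<^sup>2\<close>
  of \<open>parallel_pairs_of_coloop_free\<close> for \<open>\<rho> = s - 1\<close>. Otherwise
  deleting \<open>V = A - U\<close> loses rank, so \<open>V\<close> exceeds the deletable size,
  chosen as the density that \<open>uniform_over_exists\<close> wants in rank
  \<open>s ^ 3\<close>.\<close>

lemma parallel_pairs_or_uniform_of_robust:
  assumes s: "1 \<le> s" and A: "finite A" and T: "r A = s ^ 3"
    and rob: "\<And>D. D \<subseteq> A \<Longrightarrow> card D \<le> 4 ^ (s ^ 3)\<^sup>2 \<Longrightarrow> r (A - D) = r A"
  shows "(\<exists>C Q \<sigma>. parallel_pairs r C Q \<sigma> \<and> card Q = s) \<or> (\<exists>C X. uniform_over r s C X)"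
proof -
  define F where "F = {X. X \<subseteq> A \<and> coloop_free r X \<and> r X < s}"
  define U where "U = \<Union>F"
  have UA: "U \<subseteq> A" by (auto simp: U_def F_def)
  have finF: "finite F" using A by (auto simp: F_def intro: finite_subset[of _ "Pow A"])
  show ?thesis
  proof (cases "r U = s ^ 3")
    case True
    have "s * (s - 1)\<^sup>2 < s ^ 3"
    proof -
      have "(s - 1)\<^sup>2 < s\<^sup>2" using s by (intro power_strict_mono) auto
      then show ?thesis using s by (simp add: power2_eq_square power3_eq_cube)
    qed
    then have "\<exists>C Q \<sigma>. parallel_pairs r C Q \<sigma> \<and> card Q = s"
      using True by (intro parallel_pairs_of_coloop_free[OF finF, of "{}" "s - 1"])
        (auto simp: F_def U_def rank_empty)
    then show ?thesis ..
  next
    case False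
    define V where "V = A - U"
    have finV: "finite V" using A by (simp add: V_def)
    have AV: "A - V = U" using UA by (auto simp: V_def)
    have "\<not> card V \<le> 4 ^ (s ^ 3)\<^sup>2" using rob[of V] AV False T by (auto simp: V_def)
    moreover have "r Z = card Z" if Z: "Z \<subseteq> V" "card Z \<le> s" for Z
    proof (rule ccontr)
      assume "r Z \<noteq> card Z"
      moreover have finZ: "finite Z" using Z(1) finV by (rule finite_subset)
      ultimately obtain X where X: "X \<subseteq> Z" "X \<noteq> {}" "coloop_free r X" "r X < card X"
        using circuit_exists by blast
      have "card X \<le> card Z" using finZ X(1) by (rule card_mono)
      then have "X \<in> F" using X Z by (auto simp: F_def V_def)
      then show False using X(1,2) Z(1) by (auto simp: U_def V_def)
    qed
    moreover have "r V \<le> s ^ 3" using rank_mono[of V A] T by (simp add: V_def)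
    ultimately have "\<exists>C X. uniform_over r s C X"
      by (intro uniform_over_exists[OF s finV, of "s ^ 3"]) auto
    then show ?thesis ..
  qed
qed

text \<open>\<open>R\<close> is independent as part of \<open>B\<close>, so contracting it cuts the
  rank from \<open>card A\<close> to exactly \<open>s ^ 3\<close>, and robustness becomes invariance
  of this rank under small deletions.\<close>

lemma parallel_pairs_or_uniform:
  assumes A: "finite A" "r A = card A" and B: "finite B" "A \<inter> B = {}" "r B = card A" "card B = card A"
    and top: "r (A \<union> B) = card A" and s: "1 \<le> s"
    and big: "s ^ (s ^ 3) * 4 ^ (s ^ 3)\<^sup>2 + s ^ 3 \<le> card A"
  shows "(\<exists>C Q \<sigma>. parallel_pairs r C Q \<sigma> \<and> card Q = s) \<or> (\<exists>C X. uniform_over r s C X)"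
proof (cases "\<exists>C Q \<sigma>. parallel_pairs r C Q \<sigma> \<and> card Q = s")
  case False
  then obtain R where R: "R \<subseteq> B" "card R + s ^ 3 = card A" "robust A (4 ^ (s ^ 3)\<^sup>2) R"
    using robust_subset_or_parallel_pairs[OF A B top s _ big, of "s ^ 3"] by auto
  define r' where "r' X = r (X \<union> R) - r R" for X
  interpret r': rank_fun r' unfolding r'_def by (rule rank_fun_contract)
  have rR: "r R = card R" using indep_subset[OF B(1) _ R(1)] B(3,4) by simp
  have topR: "r (X \<union> R) \<le> card A" if "X \<subseteq> A" for X
    unfolding top[symmetric] by (rule rank_mono) (use that R(1) in auto)
  have full: "r' (A - D) = s ^ 3" if "D \<subseteq> A" "card D \<le> 4 ^ (s ^ 3)\<^sup>2" for D
  proof -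
    have "card A \<le> r ((A - D) \<union> R)" using R(3) that unfolding robust_def by blast
    moreover have "r ((A - D) \<union> R) \<le> card A" by (rule topR) auto
    ultimately show ?thesis using R(2) rR unfolding r'_def by linarith
  qed
  have rA: "r' A = s ^ 3" using full[of "{}"] by simp
  have "(\<exists>C Q \<sigma>. parallel_pairs r' C Q \<sigma> \<and> card Q = s) \<or> (\<exists>C X. uniform_over r' s C X)"
    by (rule r'.parallel_pairs_or_uniform_of_robust[OF s A(1) rA]) (simp add: full rA)
  then show ?thesis
    using parallel_pairs_contract[of R] uniform_over_contract[of R]
    unfolding r'_def[abs_def] by blast
qed simp

end

section \<open>Matroid rank and minors\<close>

text \<open>Elements outside the ground set act as loops, so this is a \<open>rank_fun\<close> on
  the whole type.\<close>

definition rank :: "'a indep_system \<Rightarrow> 'a set \<Rightarrow> nat" where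
  "rank M X = Max (card ` {I \<in> indep M. I \<subseteq> X})"

context matroid
begin

lemma finite_indep: "I \<in> indep M \<Longrightarrow> finite I"
  using indep_subset_ground finite_ground finite_subset by blast

lemma finite_card_indep: "finite (card ` {I \<in> indep M. I \<subseteq> X})"
proof -
  have "{I \<in> indep M. I \<subseteq> X} \<subseteq> Pow (ground M)" using indep_subset_ground by blast
  then show ?thesis using finite_ground by (meson finite_Pow_iff finite_imageI finite_subset)
qed

lemma card_le_rank: "I \<in> indep M \<Longrightarrow> I \<subseteq> X \<Longrightarrow> card I \<le> rank M X"
  unfolding rank_def by (rule Max_ge[OF finite_card_indep]) auto

lemma rank_witness: "\<exists>J\<in>indep M. J \<subseteq> X \<and> card J = rank M X"
proof -
  have "rank M X \<in> card ` {I \<in> indep M. I \<subseteq> X}"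
    unfolding rank_def by (rule Max_in[OF finite_card_indep]) (use indep_empty in auto)
  then show ?thesis by auto
qed

lemma indep_extends:
  assumes "I \<in> indep M" "I \<subseteq> X"
  shows "\<exists>J\<in>indep M. I \<subseteq> J \<and> J \<subseteq> X \<and> card J = rank M X"
proof -
  define P where "P n \<longleftrightarrow> (\<exists>J\<in>indep M. I \<subseteq> J \<and> J \<subseteq> X \<and> card J = n)" for n
  have bound: "n \<le> rank M X" if "P n" for n using that card_le_rank by (auto simp: P_def)
  have "P (card I)" using assms by (auto simp: P_def)
  then have "P (Greatest P)" "\<And>n. P n \<Longrightarrow> n \<le> Greatest P"
    using GreatestI_nat[of P "card I"] Greatest_le_nat[of P] bound by metis+
  then obtain J where J: "J \<in> indep M" "I \<subseteq> J" "J \<subseteq> X" and max: "\<And>n. P n \<Longrightarrow> n \<le> card J"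
    unfolding P_def by metis
  have "\<not> card J < rank M X"
  proof
    assume less: "card J < rank M X"
    obtain K where K: "K \<in> indep M" "K \<subseteq> X" "card K = rank M X" using rank_witness by blast
    then obtain e where e: "e \<in> K - J" "insert e J \<in> indep M"
      using augmentation[OF J(1) K(1)] less by auto
    have "P (Suc (card J))" unfolding P_def
      by (rule bexI[OF _ e(2)]) (use e J K finite_indep[OF J(1)] in auto)
    then show False using max by fastforce
  qed
  then show ?thesis using J card_le_rank[OF J(1,3)] by (intro bexI[OF _ J(1)]) auto
qed

lemma rank_indep: "I \<in> indep M \<Longrightarrow> rank M I = card I"
proof -
  assume I: "I \<in> indep M"
  obtain J where "J \<in> indep M" "J \<subseteq> I" "card J = rank M I" using rank_witness by blast
  then show ?thesis
    using card_mono[OF finite_indep[OF I], of J] card_le_rank[OF I, of I] by simp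
qed

lemma rank_Int_ground: "rank M (X \<inter> ground M) = rank M X"
proof -
  have "{I \<in> indep M. I \<subseteq> X \<inter> ground M} = {I \<in> indep M. I \<subseteq> X}"
    using indep_subset_ground by auto
  then show ?thesis by (simp add: rank_def)
qed

lemma rank_fun_rank: "rank_fun (rank M)"
proof
  show "rank M {} = 0" using rank_indep[OF indep_empty] by simp
  fix X Y :: "'a set" and x
  show "rank M X \<le> rank M Y" if "X \<subseteq> Y"
    using rank_witness[of X] card_le_rank[of _ Y] that by (metis subset_trans)
  show "rank M (insert x X) \<le> Suc (rank M X)"
  proof -
    obtain J where J: "J \<in> indep M" "J \<subseteq> insert x X" "card J = rank M (insert x X)"
      using rank_witness by blast
    have "J - {x} \<in> indep M" using indep_mono[OF J(1)] by blast
    then have "card (J - {x}) \<le> rank M X" by (rule card_le_rank) (use J(2) in auto)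
    moreover have "card J \<le> Suc (card (J - {x}))"
      using card_Suc_Diff1[OF finite_indep[OF J(1)], of x] by (cases "x \<in> J") auto
    ultimately show ?thesis using J(3) by simp
  qed
  show "rank M (X \<union> Y) + rank M (X \<inter> Y) \<le> rank M X + rank M Y"
  proof -
    obtain I where I: "I \<in> indep M" "I \<subseteq> X \<inter> Y" "card I = rank M (X \<inter> Y)"
      using rank_witness by blast
    obtain J where J: "J \<in> indep M" "I \<subseteq> J" "J \<subseteq> X \<union> Y" "card J = rank M (X \<union> Y)"
      using indep_extends[OF I(1), of "X \<union> Y"] I(2) by blast
    have fin: "finite J" using J(1) by (rule finite_indep)
    have "card (J \<inter> X) \<le> rank M X" "card (J \<inter> Y) \<le> rank M Y"
      using indep_mono[OF J(1)] card_le_rank by (metis Int_lower1 Int_lower2)+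
    moreover have "card (J \<inter> X) + card (J \<inter> Y) = card J + card (J \<inter> (X \<inter> Y))"
    proof -
      have "J \<inter> X \<union> J \<inter> Y = J" "J \<inter> X \<inter> (J \<inter> Y) = J \<inter> (X \<inter> Y)" using J(3) by auto
      then show ?thesis using card_Un_Int[of "J \<inter> X" "J \<inter> Y"] fin by simp
    qed
    moreover have "card I \<le> card (J \<inter> (X \<inter> Y))"
      by (rule card_mono) (use fin I J in auto)
    ultimately show ?thesis using I(3) J(4) by linarith
  qed
qed

sublocale rk: rank_fun "rank M" by (rule rank_fun_rank)

lemma card_basis_in: "basis_in M X B \<Longrightarrow> card B = rank M X"
  using indep_extends[of B X] by (auto simp: basis_in_def)

lemma basis_inI: "B \<in> indep M \<Longrightarrow> B \<subseteq> X \<Longrightarrow> card B = rank M X \<Longrightarrow> basis_in M X B"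
  unfolding basis_in_def
proof (intro conjI ballI impI)
  fix J assume "B \<in> indep M" "B \<subseteq> X" "card B = rank M X" and J: "J \<in> indep M" "B \<subseteq> J \<and> J \<subseteq> X"
  then have "card J \<le> card B" using card_le_rank[of J X] by simp
  then show "J = B" using card_seteq[of J B] finite_indep[OF J(1)] J(2) by simp
qed

section \<open>From rank conditions to minors\<close>

lemma indep_contraction_iff:
  assumes X: "X \<subseteq> ground M - C"
  shows "X \<in> indep (contraction M C) \<longleftrightarrow> rank M (C \<union> X) = rank M C + card X"
proof -
  have finX: "finite X" using X finite_ground by (meson Diff_subset finite_subset)
  have "(\<exists>B. basis_in M C B \<and> X \<union> B \<in> indep M) \<longleftrightarrow> rank M (C \<union> X) = rank M C + card X"
  proof
    assume "\<exists>B. basis_in M C B \<and> X \<union> B \<in> indep M"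
    then obtain B where B: "basis_in M C B" "X \<union> B \<in> indep M" by blast
    have BC: "B \<subseteq> C" using B(1) by (simp add: basis_in_def)
    have "card (X \<union> B) = card X + card B"
      using finite_indep[OF B(2)] BC X by (intro card_Un_disjoint) auto
    moreover have "card (X \<union> B) \<le> rank M (C \<union> X)"
      by (rule card_le_rank[OF B(2)]) (use BC in auto)
    ultimately show "rank M (C \<union> X) = rank M C + card X"
      using card_basis_in[OF B(1)] rk.rank_Un_le_card[OF finX, of C] by simp
  next
    assume r: "rank M (C \<union> X) = rank M C + card X"
    obtain B where B: "B \<in> indep M" "B \<subseteq> C" "card B = rank M C" using rank_witness by blast
    \<comment> \<open>\<open>B\<close> is a largest independent subset of \<open>C\<close>, so
      \<open>J\<close> meets \<open>C\<close> only in \<open>B\<close>; counting then forces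
      \<open>J = X \<union> B\<close>.\<close>
    obtain J where J: "J \<in> indep M" "B \<subseteq> J" "J \<subseteq> C \<union> X" "card J = rank M (C \<union> X)"
      using indep_extends[OF B(1), of "C \<union> X"] B(2) by blast
    have finJ: "finite J" using J(1) by (rule finite_indep)
    have "J \<inter> C \<in> indep M" using indep_mono[OF J(1)] by blast
    then have "card (J \<inter> C) \<le> card B" using card_le_rank[of "J \<inter> C" C] B(3) by simp
    then have "B = J \<inter> C" using J(2) B(2) finJ by (intro card_seteq) auto
    then have sub: "J \<subseteq> X \<union> B" using J(3) by auto
    have "card (X \<union> B) \<le> card J" using card_Un_le[of X B] r J(4) B(3) by simp
    then have "J = X \<union> B" using sub finX finite_indep[OF B(1)] by (intro card_seteq) auto
    then show "\<exists>B. basis_in M C B \<and> X \<union> B \<in> indep M" using J(1) basis_inI[OF B] by auto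
  qed
  then show ?thesis using X by (simp add: contraction_def)
qed

text \<open>The rank arguments contract arbitrary sets, so \<open>C\<close> may leave the ground set
  and is cut down to \<open>C'\<close>. The bijection starts at \<open>N\<close>, whose elements are
  explicit indices in both applications, and is inverted for \<open>isomorphic\<close>.\<close>

lemma has_minorI:
  assumes g: "bij_betw g (ground N) X" and X: "X \<subseteq> ground M" "X \<inter> C = {}"
    and ind: "\<And>Y. Y \<subseteq> ground N \<Longrightarrow> Y \<in> indep N \<longleftrightarrow> rank M (C \<union> g ` Y) = rank M C + card Y"
  shows "has_minor M N"
proof -
  define C' where "C' = C \<inter> ground M"
  define D where "D = ground M - C' - X"
  define f where "f = inv_into (ground N) g"
  have rC: "rank M (C \<union> Z) = rank M (C' \<union> Z)" if "Z \<subseteq> ground M" for Z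
  proof -
    have "(C \<union> Z) \<inter> ground M = C' \<union> Z" using that by (auto simp: C'_def)
    then show ?thesis using rank_Int_ground[of "C \<union> Z"] by simp
  qed
  have rC': "rank M C' = rank M C" unfolding C'_def by (rule rank_Int_ground)
  have gr: "ground (deletion (contraction M C') D) = X"
    using X by (auto simp: deletion_def contraction_def D_def C'_def)
  have ind': "Z \<in> indep (deletion (contraction M C') D) \<longleftrightarrow> f ` Z \<in> indep N" if Z: "Z \<subseteq> X" for Z
  proof -
    have gf: "g ` f ` Z = Z"
      using Z bij_betw_imp_surj_on[OF g] unfolding f_def by (rule image_inv_into_cancel[rotated])
    have sub: "f ` Z \<subseteq> ground N"
      using Z bij_betw_inv_into[OF g] unfolding f_def bij_betw_def by blast
    have "inj_on f Z" using Z bij_betw_inv_into[OF g] unfolding f_def bij_betw_def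
      by (meson inj_on_subset)
    then have "card (f ` Z) = card Z" by (rule card_image)
    then have "f ` Z \<in> indep N \<longleftrightarrow> rank M (C \<union> Z) = rank M C + card Z"
      using ind[OF sub] gf by simp
    also have "\<dots> \<longleftrightarrow> rank M (C' \<union> Z) = rank M C' + card Z"
      using rC[of Z] rC' Z X(1) by auto
    also have "\<dots> \<longleftrightarrow> Z \<in> indep (contraction M C')"
      by (rule indep_contraction_iff[symmetric]) (use Z X in \<open>auto simp: C'_def\<close>)
    also have "\<dots> \<longleftrightarrow> Z \<in> indep (deletion (contraction M C') D)"
      using Z by (auto simp: deletion_def D_def)
    finally show ?thesis by simp
  qed
  have "isomorphic (deletion (contraction M C') D) N"
    unfolding isomorphic_def gr
    using bij_betw_inv_into[OF g] ind' unfolding f_def by (intro exI[of _ f]) (auto simp: f_def)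
  moreover have "C' \<subseteq> ground M" "D \<subseteq> ground M" "C' \<inter> D = {}" by (auto simp: C'_def D_def)
  ultimately show ?thesis unfolding has_minor_def by blast
qed

lemma rank_nonloop_in_ground: "rank M C < rank M (insert x C) \<Longrightarrow> x \<in> ground M"
proof (rule ccontr)
  assume "x \<notin> ground M" and less: "rank M C < rank M (insert x C)"
  then have "insert x C \<inter> ground M = C \<inter> ground M" by auto
  then show False using rank_Int_ground[of "insert x C"] rank_Int_ground[of C] less by simp
qed

lemma has_uniform_minor:
  assumes s: "1 \<le> s" and u: "uniform_over (rank M) s C X"
  shows "has_minor M (uniform s (2 * s))"
proof -
  have cX: "card X = 2 * s" and top: "rank M (C \<union> X) = rank M C + s"
    and ind: "\<And>Z. Z \<subseteq> X \<Longrightarrow> card Z = s \<Longrightarrow> rank M (C \<union> Z) = rank M C + s"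
    using u by (auto simp: uniform_over_def)
  have finX: "finite X" using cX s by (intro card_ge_0_finite) simp
  have indep: "rank M (C \<union> Z) = rank M C + card Z" if Z: "Z \<subseteq> X" "card Z \<le> s" for Z
  proof -
    obtain Z' where Z': "Z \<subseteq> Z'" "Z' \<subseteq> X" "card Z' = s"
      using exists_subset_between[OF Z(2) _ Z(1) finX] cX by auto
    have "finite Z'" using Z'(2) finX by (rule finite_subset)
    then show ?thesis using rk.indep_over_subset[OF _ _ Z'(1)] ind[OF Z'(2,3)] Z'(3) by simp
  qed
  \<comment> \<open>Nonloops over \<open>C\<close> lie in the ground set and outside
    \<open>C\<close>, which places \<open>X\<close>.\<close>
  have nl: "rank M C < rank M (insert x C)" if "x \<in> X" for x
    using indep[of "{x}"] that s by simp
  have XE: "X \<subseteq> ground M" using nl rank_nonloop_in_ground by blast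
  have XC: "X \<inter> C = {}" using nl by (metis disjoint_iff insert_absorb less_irrefl)
  obtain g where g: "bij_betw g {..<2 * s} X"
    using finX cX by (metis ex_bij_betw_nat_finite atLeast0LessThan)
  show ?thesis
  proof (rule has_minorI[of g _ X C])
    show "bij_betw g (ground (uniform s (2 * s))) X" using g by (simp add: uniform_def)
    fix Y assume "Y \<subseteq> ground (uniform s (2 * s))"
    then have Y: "Y \<subseteq> {..<2 * s}" by (simp add: uniform_def)
    have gY: "g ` Y \<subseteq> X" using Y g unfolding bij_betw_def by blast
    have card: "card (g ` Y) = card Y"
      using Y g unfolding bij_betw_def by (meson card_image inj_on_subset)
    have "rank M (C \<union> g ` Y) \<le> rank M C + s"
      unfolding top[symmetric] by (rule rk.rank_mono) (use gY in auto)
    then have "card Y \<le> s \<longleftrightarrow> rank M (C \<union> g ` Y) = rank M C + card Y"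
      using indep[OF gY] card by auto
    then show "Y \<in> indep (uniform s (2 * s)) \<longleftrightarrow> rank M (C \<union> g ` Y) = rank M C + card Y"
      using Y by (simp add: uniform_def)
  qed (use XE XC in auto)
qed

lemma has_parallel_pairs_minor:
  assumes pp: "parallel_pairs (rank M) C Q \<sigma>" and s: "card Q = s"
  shows "has_minor M (direct_sum {..<s} (\<lambda>_. uniform 1 2))"
proof -
  have finQ: "finite Q" and rQ: "rank M (C \<union> Q) = rank M C + card Q"
    and ne: "\<And>q. q \<in> Q \<Longrightarrow> \<sigma> q \<noteq> q"
    and nl: "\<And>q. q \<in> Q \<Longrightarrow> rank M (C \<union> {\<sigma> q}) = Suc (rank M C)"
    and par: "\<And>q. q \<in> Q \<Longrightarrow> rank M (C \<union> {q, \<sigma> q}) = Suc (rank M C)"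
    using pp by (auto simp: parallel_pairs_def)
  obtain e where e: "bij_betw e {..<s} Q"
    using finQ s by (metis ex_bij_betw_nat_finite atLeast0LessThan)
  have eQ: "e i \<in> Q" if "i < s" for i using e that unfolding bij_betw_def by auto
  define g where "g p = (if snd p = 0 then e (fst p) else \<sigma> (e (fst p)))" for p :: "nat \<times> nat"
  let ?G = "{..<s} \<times> {..<2::nat}"
  have single: "rank M (C \<union> {q}) = Suc (rank M C)" if "q \<in> Q" for q
    using rk.indep_over_subset[OF finQ rQ, of "{q}"] that by simp
  have nlg: "rank M (insert (g p) C) = Suc (rank M C)" if "p \<in> ?G" for p
    using single[OF eQ] nl[OF eQ] that by (auto simp: g_def)
  have parg: "rank M (C \<union> {e i, g (i, j)}) = Suc (rank M C)" if "i < s" for i j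
    using par[OF eQ[OF that]] single[OF eQ[OF that]] by (auto simp: g_def)
  text \<open>Any choice of one element from each of several pairs is independent, since over \<^term>\<open>C\<close>
    it spans the corresponding elements of \<^term>\<open>Q\<close>.\<close>
  have span: "rank M (C \<union> g ` Y) \<ge> rank M C + card (fst ` Y)" if Y: "Y \<subseteq> ?G" for Y
  proof -
    let ?S = "C \<union> g ` Y"
    have finY: "finite Y" using Y by (rule finite_subset) simp
    have "rank M (?S \<union> {e (fst p)}) = rank M ?S" if p: "p \<in> Y" for p
    proof -
      have pG: "fst p < s" "(fst p, snd p) = p" "p \<in> ?G" using p Y by auto
      have eqs: "C \<union> {g p} \<union> {e (fst p)} = C \<union> {e (fst p), g p}" by auto
      have "rank M (?S \<union> {e (fst p)}) + rank M (C \<union> {g p}) \<le> rank M ?S + rank M (C \<union> {g p} \<union> {e (fst p)})"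
        by (rule rk.rank_Un_diff_le) (use p in auto)
      moreover have "rank M (C \<union> {g p} \<union> {e (fst p)}) = Suc (rank M C)"
        unfolding eqs using parg[OF pG(1), of "snd p"] pG(2) by simp
      moreover have "rank M (C \<union> {g p}) = Suc (rank M C)" using nlg[OF pG(3)] by simp
      moreover have "rank M ?S \<le> rank M (?S \<union> {e (fst p)})" by (rule rk.rank_mono) auto
      ultimately show ?thesis by linarith
    qed
    then have "rank M (?S \<union> \<Union>((\<lambda>p. {e (fst p)}) ` Y)) = rank M ?S"
      by (intro rk.rank_Un_Union_eq) (use finY in auto)
    moreover have "rank M (C \<union> e ` fst ` Y) \<le> rank M (?S \<union> \<Union>((\<lambda>p. {e (fst p)}) ` Y))"
      by (rule rk.rank_mono) auto
    moreover have "rank M (C \<union> e ` fst ` Y) = rank M C + card (e ` fst ` Y)"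
      by (rule rk.indep_over_subset[OF finQ rQ]) (use Y eQ in auto)
    moreover have "card (e ` fst ` Y) = card (fst ` Y)"
    proof (rule card_image)
      have "fst ` Y \<subseteq> {..<s}" using Y by auto
      then show "inj_on e (fst ` Y)" using e unfolding bij_betw_def by (meson inj_on_subset)
    qed
    ultimately show ?thesis by linarith
  qed
  have inj: "inj_on g ?G"
  proof (rule inj_onI)
    fix p q assume p: "p \<in> ?G" and q: "q \<in> ?G" and eq: "g p = g q"
    \<comment> \<open>By \<open>span\<close>, elements taken from two different pairs have rank at
      least two together, so they cannot coincide.\<close>
    have "fst p = fst q"
    proof (rule ccontr)
      assume "fst p \<noteq> fst q"
      then have "rank M C + 2 \<le> rank M (C \<union> {g p})" using span[of "{p, q}"] p q eq by auto
      then show False using nlg[OF p] by simp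
    qed
    moreover have "snd p = snd q"
      using eq ne[OF eQ[of "fst p"]] p q \<open>fst p = fst q\<close> by (auto simp: g_def split: if_splits)
    ultimately show "p = q" by (rule prod_eqI)
  qed
  show ?thesis
  proof (rule has_minorI[of g _ "g ` ?G" C])
    have ground: "ground (direct_sum {..<s} (\<lambda>_. uniform 1 2)) = ?G"
      by (auto simp: direct_sum_def uniform_def)
    show "bij_betw g (ground (direct_sum {..<s} (\<lambda>_. uniform 1 2))) (g ` ?G)"
      unfolding ground using inj by (rule inj_on_imp_bij_betw)
    show "g ` ?G \<subseteq> ground M"
    proof
      fix x assume "x \<in> g ` ?G"
      then have "rank M C < rank M (insert x C)" using nlg by force
      then show "x \<in> ground M" by (rule rank_nonloop_in_ground)
    qed
    show "g ` ?G \<inter> C = {}"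
    proof (rule equals0I)
      fix x assume x: "x \<in> g ` ?G \<inter> C"
      then have "rank M (insert x C) = Suc (rank M C)" using nlg by force
      moreover have "insert x C = C" using x by auto
      ultimately show False by simp
    qed
    fix Y assume "Y \<subseteq> ground (direct_sum {..<s} (\<lambda>_. uniform 1 2))"
    then have Y: "Y \<subseteq> ?G" unfolding ground .
    have finY: "finite Y" using Y by (rule finite_subset) simp
    have cg: "card (g ` Y) = card Y" using inj Y by (meson card_image inj_on_subset)
    have "Y \<in> indep (direct_sum {..<s} (\<lambda>_. uniform 1 2)) \<longleftrightarrow> (\<forall>i<s. card {j. (i, j) \<in> Y} \<le> 1)"
      using Y by (force simp: direct_sum_def uniform_def)
    also have "\<dots> \<longleftrightarrow> inj_on fst Y"
    proof
      assume le1: "\<forall>i<s. card {j. (i, j) \<in> Y} \<le> 1"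
      show "inj_on fst Y"
      proof (rule inj_onI)
        fix p q assume pq: "p \<in> Y" "q \<in> Y" "fst p = fst q"
        have "{j. (fst p, j) \<in> Y} \<subseteq> {..<2}" using Y by auto
        then have "finite {j. (fst p, j) \<in> Y}" by (rule finite_subset) simp
        moreover have "card {j. (fst p, j) \<in> Y} \<le> 1" using le1 pq(1) Y by auto
        moreover have "snd p \<in> {j. (fst p, j) \<in> Y}" using pq(1) by simp
        moreover have "snd q \<in> {j. (fst p, j) \<in> Y}" unfolding pq(3) using pq(2) by simp
        ultimately have "snd p = snd q" by (metis One_nat_def card_le_Suc0_iff_eq)
        then show "p = q" using pq(3) by (intro prod_eqI)
      qed
    next
      assume inj: "inj_on fst Y"
      show "\<forall>i<s. card {j. (i, j) \<in> Y} \<le> 1"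
      proof (intro allI impI)
        fix i assume "i < s"
        have "{j. (i, j) \<in> Y} \<subseteq> {..<2}" using Y by auto
        then have "finite {j. (i, j) \<in> Y}" by (rule finite_subset) simp
        moreover have "a = b" if "(i, a) \<in> Y" "(i, b) \<in> Y" for a b
          using inj_onD[OF inj, of "(i, a)" "(i, b)"] that by simp
        ultimately show "card {j. (i, j) \<in> Y} \<le> 1" by (auto simp: card_le_Suc0_iff_eq)
      qed
    qed
    also have "\<dots> \<longleftrightarrow> rank M (C \<union> g ` Y) = rank M C + card Y"
    proof
      assume "inj_on fst Y"
      then have "card (fst ` Y) = card Y" by (rule card_image)
      then show "rank M (C \<union> g ` Y) = rank M C + card Y"
        using span[OF Y] rk.rank_Un_le_card[of "g ` Y" C] finY cg by simp
    next
      assume "rank M (C \<union> g ` Y) = rank M C + card Y"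
      then have full: "rank M (C \<union> g ` Y) = rank M C + card (g ` Y)" using cg by simp
      show "inj_on fst Y"
      proof (rule inj_onI, rule ccontr)
        fix p q assume pq: "p \<in> Y" "q \<in> Y" "fst p = fst q" "p \<noteq> q"
        have i: "fst p < s" using pq(1) Y by auto
        have "rank M (C \<union> {g p, g q}) = rank M C + card {g p, g q}"
          by (rule rk.indep_over_subset[OF _ full]) (use pq finY in auto)
        moreover have "g p \<noteq> g q" using inj_onD[OF inj, of p q] pq Y by auto
        moreover have "C \<union> {g p, g q} \<subseteq> C \<union> {e (fst p), \<sigma> (e (fst p))}"
          using pq(3) by (auto simp: g_def)
        then have "rank M (C \<union> {g p, g q}) \<le> rank M (C \<union> {e (fst p), \<sigma> (e (fst p))})"
          by (rule rk.rank_mono)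
        ultimately show False using par[OF eQ[OF i]] by simp
      qed
    qed
    finally show "Y \<in> indep (direct_sum {..<s} (\<lambda>_. uniform 1 2))
      \<longleftrightarrow> rank M (C \<union> g ` Y) = rank M C + card Y" .
  qed
qed

end

section \<open>Perturbations\<close>

text \<open>Elements of \<open>G - H\<close> become loops, and nonloops of \<open>H\<close> with
  equal images become parallel. The first serves to add a loop, the second to add a parallel
  copy.\<close>

definition pullback :: "('b \<Rightarrow> 'a) \<Rightarrow> 'b set \<Rightarrow> 'b set \<Rightarrow> 'a indep_system \<Rightarrow> 'b indep_system" where
  "pullback f G H M = \<lparr>ground = G, indep = {X. X \<subseteq> H \<and> inj_on f X \<and> f ` X \<in> indep M}\<rparr>"

text \<open>For a loop \<^term>\<open>a\<close>, this is the matroid union of \<^term>\<open>M\<close> with \<open>U\<^bsub>1,2\<^esub>\<close> on \<^term>\<open>{a, b}\<close>, that is, the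
  coextension putting \<^term>\<open>a\<close> in series with \<^term>\<open>b\<close>.\<close>

definition series_union :: "'a \<Rightarrow> 'a \<Rightarrow> 'a indep_system \<Rightarrow> 'a indep_system" where
  "series_union a b M = \<lparr>ground = ground M,
     indep = {X. X \<subseteq> ground M \<and> (X \<in> indep M \<or> (\<exists>x\<in>X \<inter> {a, b}. X - {x} \<in> indep M))}\<rparr>"

text \<open>For independent \<open>D\<close>: contract \<open>D\<close> and put it back as
  loops.\<close>

definition loopify :: "'a set \<Rightarrow> 'a indep_system \<Rightarrow> 'a indep_system" where
  "loopify D M = \<lparr>ground = ground M, indep = {I. I \<inter> D = {} \<and> I \<union> D \<in> indep M}\<rparr>"

text \<open>Delete \<open>H\<close> and put it back as coloops.\<close>

definition coloopify :: "'a set \<Rightarrow> 'a indep_system \<Rightarrow> 'a indep_system" where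
  "coloopify H M = \<lparr>ground = ground M, indep = {I. I \<subseteq> ground M \<and> I - H \<in> indep M}\<rparr>"

lemma matroid_pullback:
  assumes M: "matroid M" and G: "finite G" "H \<subseteq> G"
  shows "matroid (pullback f G H M)"
proof -
  interpret matroid M by (rule M)
  show ?thesis
  proof (unfold_locales, goal_cases)
    case 1
    then show ?case using G by (simp add: pullback_def)
  next
    case (2 X)
    then show ?case using G by (auto simp: pullback_def)
  next
    case 3
    then show ?case using indep_empty by (simp add: pullback_def)
  next
    case (4 X Y)
    then show ?case using indep_mono[of "f ` X" "f ` Y"]
      by (auto simp: pullback_def image_mono intro: inj_on_subset)
  next
    case (5 X Y)
    then have X: "X \<subseteq> H" "inj_on f X" "f ` X \<in> indep M"
      and Y: "Y \<subseteq> H" "inj_on f Y" "f ` Y \<in> indep M" by (auto simp: pullback_def)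
    have "card (f ` X) < card (f ` Y)" using 5(3) card_image[OF X(2)] card_image[OF Y(2)] by simp
    then obtain y where y: "y \<in> Y" "f y \<notin> f ` X" "insert (f y) (f ` X) \<in> indep M"
      using augmentation[OF X(3) Y(3)] by auto
    then have "y \<in> Y - X" "insert y X \<in> indep (pullback f G H M)"
      using X Y by (auto simp: pullback_def)
    then show ?case by blast
  qed
qed

text \<open>Independent sets are those of \<open>M\<close> with at most one of \<open>a\<close>,
  \<open>b\<close> adjoined. Augmentation is done in \<open>M\<close> on the parts without the
  adjoined element, which is put back afterwards.\<close>

lemma matroid_series_union:
  assumes M: "matroid M" and ab: "a \<in> ground M" "b \<in> ground M" "a \<noteq> b" and loop: "{a} \<notin> indep M"
  shows "matroid (series_union a b M)"
proof -
  interpret matroid M by (rule M)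
  have na: "a \<notin> I" if "I \<in> indep M" for I using indep_mono[OF that, of "{a}"] loop by auto
  let ?P = "\<lambda>X. X \<subseteq> ground M \<and> (X \<in> indep M \<or> (\<exists>x\<in>X \<inter> {a, b}. X - {x} \<in> indep M))"
  have decomp: "\<exists>X0\<in>indep M. X0 \<subseteq> X \<and> (X = X0 \<or> (\<exists>x\<in>{a, b}. x \<notin> X0 \<and> X = insert x X0))" if "?P X" for X
    using that
  proof (elim conjE disjE bexE)
    assume "X \<in> indep M"
    then show ?thesis by auto
  next
    fix x assume "x \<in> X \<inter> {a, b}" "X - {x} \<in> indep M"
    then show ?thesis by (intro bexI[of _ "X - {x}"]) auto
  qed
  have P0: "?P I" if "I \<in> indep M" for I using that indep_subset_ground by auto
  have P1: "?P (insert x I)" if "I \<in> indep M" "x \<in> {a, b}" for I x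
  proof (cases "x \<in> I")
    case True
    then show ?thesis using P0[OF that(1)] by (simp add: insert_absorb)
  next
    case False
    then have "insert x I - {x} = I" by auto
    then show ?thesis using that indep_subset_ground[OF that(1)] ab by auto
  qed
  have aug: "\<exists>e\<in>Y - X. ?P (insert e X)" if X: "?P X" and Y: "?P Y" and less: "card X < card Y" for X Y
  proof -
    obtain X0 where X0: "X0 \<in> indep M" "X = X0 \<or> (\<exists>x\<in>{a, b}. x \<notin> X0 \<and> X = insert x X0)"
      using decomp[OF X] by blast
    obtain Y0 where Y0: "Y0 \<in> indep M" "Y = Y0 \<or> (\<exists>y\<in>{a, b}. y \<notin> Y0 \<and> Y = insert y Y0)"
      using decomp[OF Y] by blast
    have fin: "finite X0" "finite Y0" using X0(1) Y0(1) finite_indep by auto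
    show ?thesis
    proof (cases "X \<in> indep M")
      case True
      note XI = True
      show ?thesis
      proof (cases "Y \<in> indep M")
        case True
        then show ?thesis using augmentation[OF XI _ less] P0 by blast
      next
        case False
        then obtain y where y: "y \<in> {a, b}" "y \<notin> Y0" "Y = insert y Y0" using Y0 by blast
        show ?thesis
        proof (cases "y \<in> X")
          case False
          then show ?thesis using P1[OF XI y(1)] y(3) by blast
        next
          case True
          \<comment> \<open>Recasting \<open>y\<close> as the adjoined element of \<open>X\<close>
            makes the rest small enough to be augmented from \<open>Y0\<close>.\<close>
          have "card (X - {y}) < card X"
            by (rule card_Diff1_less) (use True finite_indep[OF XI] in auto)
          moreover have "card X \<le> card Y0" using less y fin by simp
          moreover have "X - {y} \<in> indep M" using indep_mono[OF XI] by blast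
          ultimately obtain z where z: "z \<in> Y0 - (X - {y})" "insert z (X - {y}) \<in> indep M"
            using augmentation[OF _ Y0(1)] by (meson le_trans less_le_trans)
          have "insert y (insert z (X - {y})) = insert z X" using True by auto
          then have "?P (insert z X)" using P1[OF z(2) y(1)] by simp
          moreover have "z \<in> Y - X" using z(1) y(2,3) by auto
          ultimately show ?thesis by blast
        qed
      qed
    next
      case False
      then obtain x where x: "x \<in> {a, b}" "x \<notin> X0" "X = insert x X0" using X0 by blast
      have "card Y \<le> Suc (card Y0)" using Y0(2) fin by auto
      then have "card X0 < card Y0" using less x fin by simp
      then obtain z where z: "z \<in> Y0 - X0" "insert z X0 \<in> indep M"
        using augmentation[OF X0(1) Y0(1)] by blast
      have "z \<noteq> x" using z(2) x(3) False by auto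
      then have "z \<in> Y - X" using z(1) x(3) Y0(2) by auto
      moreover have "insert z X = insert x (insert z X0)" using x(3) by auto
      then have "?P (insert z X)" using P1[OF z(2) x(1)] by simp
      ultimately show ?thesis by blast
    qed
  qed
  have mono: "?P Y" if X: "?P X" and sub: "Y \<subseteq> X" for X Y
  proof -
    have "Y - {x} \<in> indep M" if "X - {x} \<in> indep M" for x
      using indep_mono[OF that, of "Y - {x}"] sub by blast
    moreover have "Y \<in> indep M" if "X - {x} \<in> indep M" "x \<notin> Y" for x
      using indep_mono[OF that(1), of Y] sub that(2) by blast
    moreover have "Y \<in> indep M" if "X \<in> indep M" using indep_mono[OF that sub] .
    ultimately show ?thesis using X sub by blast
  qed
  show ?thesis
  proof (unfold_locales, goal_cases)
    case 1
    then show ?case using finite_ground by (simp add: series_union_def)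
  next
    case (2 X)
    then show ?case by (simp add: series_union_def)
  next
    case 3
    then show ?case using indep_empty by (simp add: series_union_def)
  next
    case (4 X Y)
    then show ?case using mono[of X Y] by (simp add: series_union_def)
  next
    case (5 X Y)
    then show ?case using aug[of X Y] by (simp add: series_union_def)
  qed
qed

lemma matroid_loopify:
  assumes M: "matroid M" and D: "D \<in> indep M"
  shows "matroid (loopify D M)"
proof -
  interpret matroid M by (rule M)
  show ?thesis
  proof (unfold_locales, goal_cases)
    case 1
    then show ?case using finite_ground by (simp add: loopify_def)
  next
    case (2 X)
    then have "X \<union> D \<in> indep M" by (simp add: loopify_def)
    then show ?case using indep_subset_ground[of "X \<union> D"] by (simp add: loopify_def)
  next
    case 3
    then show ?case using D by (simp add: loopify_def)
  next
    case (4 X Y)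
    then have "X \<inter> D = {}" "X \<union> D \<in> indep M" by (auto simp: loopify_def)
    then show ?case using indep_mono[of "X \<union> D" "Y \<union> D"] 4(2) by (auto simp: loopify_def)
  next
    case (5 X Y)
    then have X: "X \<inter> D = {}" "X \<union> D \<in> indep M" and Y: "Y \<inter> D = {}" "Y \<union> D \<in> indep M"
      by (auto simp: loopify_def)
    have "card (X \<union> D) < card (Y \<union> D)"
      using finite_indep[OF X(2)] finite_indep[OF Y(2)] X(1) Y(1) 5(3) by (simp add: card_Un_disjoint)
    then obtain e where e: "e \<in> Y \<union> D - (X \<union> D)" "insert e (X \<union> D) \<in> indep M"
      using augmentation[OF X(2) Y(2)] by blast
    then show ?case using X(1) by (intro bexI[of _ e]) (auto simp: loopify_def)
  qed
qed

lemma matroid_coloopify: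
  assumes M: "matroid M"
  shows "matroid (coloopify H M)"
proof -
  interpret matroid M by (rule M)
  show ?thesis
  proof (unfold_locales, goal_cases)
    case 1
    then show ?case using finite_ground by (simp add: coloopify_def)
  next
    case (2 X)
    then show ?case by (simp add: coloopify_def)
  next
    case 3
    then show ?case using indep_empty by (simp add: coloopify_def)
  next
    case (4 X Y)
    then show ?case using indep_mono[of "X - H" "Y - H"] by (auto simp: coloopify_def)
  next
    case (5 X Y)
    then have X: "X \<subseteq> ground M" "X - H \<in> indep M" and Y: "Y \<subseteq> ground M" "Y - H \<in> indep M"
      by (auto simp: coloopify_def)
    have fin: "finite X" "finite Y" using X(1) Y(1) finite_ground finite_subset by auto
    show ?case
    proof (cases "Y \<inter> H \<subseteq> X")
      case False
      then obtain h where h: "h \<in> Y" "h \<in> H" "h \<notin> X" by auto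
      then have "insert h X - H = X - H" by auto
      then show ?thesis using h X Y(1) by (intro bexI[of _ h]) (auto simp: coloopify_def)
    next
      case True
      have "card X = card (X - H) + card (X \<inter> H)" "card Y = card (Y - H) + card (Y \<inter> H)"
        using card_Int_Diff[OF fin(1), of H] card_Int_Diff[OF fin(2), of H] by auto
      moreover have "card (Y \<inter> H) \<le> card (X \<inter> H)" by (rule card_mono) (use fin True in auto)
      ultimately have "card (X - H) < card (Y - H)" using 5(3) by linarith
      then obtain e where e: "e \<in> Y - H - (X - H)" "insert e (X - H) \<in> indep M"
        using augmentation[OF X(2) Y(2)] by blast
      then have "insert e X - H = insert e (X - H)" by auto
      then show ?thesis using e X Y(1) by (intro bexI[of _ e]) (auto simp: coloopify_def)
    qed
  qed
qed

section \<open>Elementary steps on matroids tagged by \<open>Some\<close>\<close>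

lemma image_Some_iff: "X \<in> (`) Some ` S \<longleftrightarrow> None \<notin> X \<and> the ` X \<in> S"
proof
  assume "X \<in> (`) Some ` S"
  then show "None \<notin> X \<and> the ` X \<in> S" by (auto simp: image_image)
next
  assume X: "None \<notin> X \<and> the ` X \<in> S"
  have "Some (the x) = x" if "x \<in> X" for x using X that by (cases x) auto
  then have "Some ` the ` X = X" by (simp add: image_image)
  then show "X \<in> (`) Some ` S" using X by (metis image_eqI)
qed

lemma inj_on_the: "None \<notin> X \<Longrightarrow> inj_on the X"
  by (rule inj_onI) (metis option.expand)

lemma subset_image_Some_iff: "X \<subseteq> Some ` E \<longleftrightarrow> None \<notin> X \<and> the ` X \<subseteq> E"
proof
  assume "X \<subseteq> Some ` E"
  then show "None \<notin> X \<and> the ` X \<subseteq> E" by auto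
next
  assume "None \<notin> X \<and> the ` X \<subseteq> E"
  then show "X \<subseteq> Some ` E" by (metis image_iff image_subset_iff option.collapse subsetI)
qed

text \<open>Adds \<open>None\<close> as a loop. The unspecified value \<open>the None\<close> is
  harmless because \<open>None\<close> lies outside the third argument of
  \<open>pullback\<close>.\<close>

definition loop_ext :: "'a indep_system \<Rightarrow> 'a option indep_system" where
  "loop_ext M = pullback the (insert None (Some ` ground M)) (Some ` ground M) M"

context matroid
begin

lemma matroid_loop_ext: "matroid (loop_ext M)"
  unfolding loop_ext_def
  by (rule matroid_pullback) (auto simp: finite_ground matroid_axioms)

lemma ground_loop_ext: "ground (loop_ext M) = insert None (Some ` ground M)"
  by (simp add: loop_ext_def pullback_def)

lemma indep_loop_ext: "X \<in> indep (loop_ext M) \<longleftrightarrow> None \<notin> X \<and> the ` X \<in> indep M"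
  using indep_subset_ground[of "the ` X"] inj_on_the[of X]
  by (auto simp: loop_ext_def pullback_def subset_image_Some_iff)

text \<open>Contracting a loop equals deleting it. This trivial step pads sequences, since
  \<open>perturbation k\<close> demands exactly \<open>k\<close> steps.\<close>

lemma elementary_projection_refl: "elementary_projection M M"
proof -
  have del: "deletion (loop_ext M) {None} = relabel Some M"
    by (auto simp: deletion_def relabel_def ground_loop_ext indep_loop_ext image_Some_iff image_image)
  have "basis_in (loop_ext M) {None} B \<longleftrightarrow> B = {}" for B
    using indep_empty by (auto simp: basis_in_def indep_loop_ext subset_singleton_iff)
  then have "X \<in> indep (contraction (loop_ext M) {None}) \<longleftrightarrow> None \<notin> X \<and> the ` X \<in> indep M" for X
    using subset_image_Some_iff[of X "ground M"] indep_subset_ground[of "the ` X"]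
    by (auto simp: contraction_def ground_loop_ext indep_loop_ext)
  then have con: "relabel Some M = contraction (loop_ext M) {None}"
    by (intro indep_system.equality set_eqI)
      (auto simp: relabel_def image_Some_iff contraction_def ground_loop_ext)
  show ?thesis
    unfolding elementary_projection_def extension_def
    using matroid_loop_ext del con ground_loop_ext by blast
qed

text \<open>The new element is a parallel copy of \<open>e\<close>; contracting it turns
  \<open>e\<close> into a loop.\<close>

lemma elementary_projection_loopify:
  assumes e: "{e} \<in> indep M"
  shows "elementary_projection M (loopify {e} M)"
proof -
  define f where "f x = (case x of None \<Rightarrow> e | Some y \<Rightarrow> y)" for x
  have f: "f None = e" "\<And>y. f (Some y) = y" by (simp_all add: f_def)
  have fX: "f ` X = the ` X" if "None \<notin> X" for X
    using that by (intro image_cong refl) (metis f(2) option.collapse)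
  define P where "P = pullback f (insert None (Some ` ground M)) (insert None (Some ` ground M)) M"
  have eE: "e \<in> ground M" using indep_subset_ground[OF e] by simp
  have mat: "matroid P"
    unfolding P_def by (rule matroid_pullback) (auto simp: finite_ground matroid_axioms)
  have gr: "ground P = insert None (Some ` ground M)" by (simp add: P_def pullback_def)
  have out: "X \<in> indep P \<longleftrightarrow> the ` X \<in> indep M" if "None \<notin> X" for X
  proof -
    have "inj_on f X" using inj_on_the[OF that] that by (metis f(2) inj_on_cong option.collapse)
    moreover have "X \<subseteq> insert None (Some ` ground M)" if "the ` X \<in> indep M"
      using indep_subset_ground[OF that] \<open>None \<notin> X\<close> subset_image_Some_iff[of X "ground M"] by auto
    ultimately show ?thesis using fX[OF that] by (auto simp: P_def pullback_def)
  qed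
  have into: "insert None X \<in> indep P \<longleftrightarrow> e \<notin> the ` X \<and> insert e (the ` X) \<in> indep M" if X: "None \<notin> X" for X
  proof -
    have "inj_on f X" using inj_on_the[OF X] X by (metis f(2) inj_on_cong option.collapse)
    moreover have "X \<subseteq> insert None (Some ` ground M)" if "insert e (the ` X) \<in> indep M"
      using indep_subset_ground[OF that] X subset_image_Some_iff[of X "ground M"] by auto
    moreover have "X - {None} = X" using X by auto
    ultimately show ?thesis using fX[OF X] f(1) by (auto simp: P_def pullback_def)
  qed
  have del: "deletion P {None} = relabel Some M"
    using out by (auto simp: deletion_def relabel_def gr image_Some_iff image_image)
  have "{None} \<in> indep P" using into[of "{}"] e by simp
  then have basis: "basis_in P {None} B \<longleftrightarrow> B = {None}" for B
    by (auto simp: basis_in_def subset_singleton_iff)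
  have "indep (contraction P {None}) = (`) Some ` indep (loopify {e} M)"
  proof (rule set_eqI)
    fix X
    have "X \<in> indep (contraction P {None}) \<longleftrightarrow> None \<notin> X \<and> X \<subseteq> Some ` ground M \<and> insert None X \<in> indep P"
      by (auto simp: contraction_def basis gr)
    also have "\<dots> \<longleftrightarrow> None \<notin> X \<and> the ` X \<in> indep (loopify {e} M)"
      using into[of X] indep_subset_ground[of "insert e (the ` X)"]
      by (auto simp: loopify_def subset_image_Some_iff)
    finally show "X \<in> indep (contraction P {None}) \<longleftrightarrow> X \<in> (`) Some ` indep (loopify {e} M)"
      by (simp add: image_Some_iff)
  qed
  moreover have "ground (contraction P {None}) = Some ` ground (loopify {e} M)"
    by (auto simp: contraction_def gr loopify_def)
  ultimately have "relabel Some (loopify {e} M) = contraction P {None}"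
    by (simp add: relabel_def)
  then show ?thesis
    unfolding elementary_projection_def extension_def using mat gr del by blast
qed

text \<open>In \<open>P\<close> one of \<open>None\<close> and \<open>Some e\<close> may be adjoined
  freely. Contracting \<open>None\<close> uses up this freedom and returns \<open>M\<close>;
  deleting \<open>None\<close> reserves it for \<open>e\<close>, which becomes a coloop.\<close>

lemma elementary_lift_coloopify:
  assumes e: "e \<in> ground M"
  shows "elementary_lift M (coloopify {e} M)"
proof -
  define P where "P = series_union None (Some e) (loop_ext M)"
  have mat: "matroid P"
    unfolding P_def
    by (rule matroid_series_union[OF matroid_loop_ext]) (use e in \<open>auto simp: ground_loop_ext indep_loop_ext\<close>)
  have gr: "ground P = insert None (Some ` ground M)" by (simp add: P_def series_union_def ground_loop_ext)
  have indP: "X \<in> indep P \<longleftrightarrow> X \<subseteq> insert None (Some ` ground M) \<and>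
      (X \<in> indep (loop_ext M) \<or> (\<exists>x\<in>X \<inter> {None, Some e}. X - {x} \<in> indep (loop_ext M)))" for X
    by (simp add: P_def series_union_def ground_loop_ext)
  have out: "X \<in> indep P \<longleftrightarrow> the ` X \<in> indep (coloopify {e} M)" if X: "None \<notin> X" for X
  proof -
    have sub: "X \<subseteq> insert None (Some ` ground M) \<longleftrightarrow> the ` X \<subseteq> ground M"
      using subset_image_Some_iff[of X "ground M"] X by auto
    have diff: "the ` (X - {Some e}) = the ` X - {e}"
    proof -
      have "the ` (X - {Some e}) = the ` X - the ` {Some e}"
        by (rule inj_on_image_set_diff[OF inj_on_the[of "insert (Some e) X"]]) (use X in auto)
      then show ?thesis by simp
    qed
    have mem: "Some e \<in> X \<longleftrightarrow> e \<in> the ` X"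
    proof
      assume "e \<in> the ` X"
      then obtain x where "x \<in> X" "e = the x" by blast
      then show "Some e \<in> X" using X by (cases x) auto
    qed (use image_iff in force)
    show ?thesis
    proof (cases "Some e \<in> X")
      case True
      then have "X \<inter> {None, Some e} = {Some e}" using X by auto
      moreover have "the ` X \<in> indep M \<Longrightarrow> the ` X - {e} \<in> indep M" by (rule indep_mono) auto
      ultimately show ?thesis using X by (auto simp: indP sub indep_loop_ext diff coloopify_def)
    next
      case False
      then have "X \<inter> {None, Some e} = {}" "the ` X - {e} = the ` X" using X mem by auto
      then show ?thesis using X indep_subset_ground by (auto simp: indP sub indep_loop_ext coloopify_def)
    qed
  qed
  have into: "insert None X \<in> indep P \<longleftrightarrow> the ` X \<in> indep M" if X: "None \<notin> X" for X
  proof -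
    have "insert None X - {None} = X" using X by auto
    moreover have "the ` X \<in> indep M \<Longrightarrow> X \<subseteq> Some ` ground M"
      using indep_subset_ground[of "the ` X"] subset_image_Some_iff[of X "ground M"] X by blast
    ultimately show ?thesis using X unfolding indP indep_loop_ext by auto
  qed
  have "indep (deletion P {None}) = (`) Some ` indep (coloopify {e} M)"
  proof (rule set_eqI)
    fix X
    have "X \<in> indep (deletion P {None}) \<longleftrightarrow> X \<in> indep P \<and> None \<notin> X"
      by (auto simp: deletion_def)
    then show "X \<in> indep (deletion P {None}) \<longleftrightarrow> X \<in> (`) Some ` indep (coloopify {e} M)"
      using out[of X] by (auto simp: image_Some_iff)
  qed
  moreover have "ground (deletion P {None}) = Some ` ground (coloopify {e} M)"
    by (auto simp: deletion_def gr coloopify_def)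
  ultimately have del: "relabel Some (coloopify {e} M) = deletion P {None}"
    by (simp add: relabel_def)
  have "{None} \<in> indep P" using into[of "{}"] indep_empty by simp
  then have basis: "basis_in P {None} B \<longleftrightarrow> B = {None}" for B
    by (auto simp: basis_in_def subset_singleton_iff)
  have "indep (contraction P {None}) = (`) Some ` indep M"
  proof (rule set_eqI)
    fix X
    have "X \<in> indep (contraction P {None}) \<longleftrightarrow> None \<notin> X \<and> X \<subseteq> Some ` ground M \<and> insert None X \<in> indep P"
      by (auto simp: contraction_def basis gr)
    also have "\<dots> \<longleftrightarrow> None \<notin> X \<and> the ` X \<in> indep M"
      using into[of X] indep_subset_ground[of "the ` X"] subset_image_Some_iff[of X "ground M"] by auto
    finally show "X \<in> indep (contraction P {None}) \<longleftrightarrow> X \<in> (`) Some ` indep M"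
      by (simp add: image_Some_iff)
  qed
  moreover have "ground (contraction P {None}) = Some ` ground M"
    by (auto simp: contraction_def gr)
  ultimately have "contraction P {None} = relabel Some M" by (simp add: relabel_def)
  then show ?thesis
    unfolding elementary_lift_def coextension_def using mat gr del by blast
qed

end

section \<open>Sequences of elementary steps\<close>

lemma perturbation_trans:
  "perturbation j L M \<Longrightarrow> perturbation k M N \<Longrightarrow> perturbation (j + k) L N"
  unfolding perturbation_def relpowp_add by (rule relcomppI)

lemma perturbation_refl: "matroid M \<Longrightarrow> perturbation k M M"
proof (induction k)
  case (Suc k)
  then have "elementary_projection M M" by (intro matroid.elementary_projection_refl)
  then show ?case using Suc unfolding perturbation_def by auto
qed (simp add: perturbation_def)

lemma perturbation_loopify:
  assumes M: "matroid M" and D: "D \<in> indep M"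
  shows "perturbation (card D) M (loopify D M)"
proof -
  interpret matroid M by (rule M)
  have "perturbation (card D') M (loopify D' M)" if "D' \<subseteq> D" for D'
    using finite_subset[OF that finite_indep[OF D]] that
  proof (induction D' rule: finite_induct)
    case empty
    have "loopify {} M = M" by (simp add: loopify_def)
    then show ?case by (simp add: perturbation_def)
  next
    case (insert e D')
    have ins: "insert e D' \<in> indep M" "D' \<in> indep M"
      using indep_mono[OF D] insert.prems by auto
    have "{e} \<in> indep (loopify D' M)" using ins insert.hyps(2) by (simp add: loopify_def)
    moreover have "matroid (loopify D' M)" by (rule matroid_loopify[OF M ins(2)])
    ultimately have "elementary_projection (loopify D' M) (loopify {e} (loopify D' M))"
      by (intro matroid.elementary_projection_loopify)
    moreover have "loopify {e} (loopify D' M) = loopify (insert e D') M"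
      using insert.hyps(2) by (auto simp: loopify_def Un_assoc)
    ultimately show ?case using insert unfolding perturbation_def by auto
  qed
  then show ?thesis by simp
qed

lemma perturbation_coloopify:
  assumes M: "matroid M" and H: "H \<subseteq> ground M"
  shows "perturbation (card H) M (coloopify H M)"
proof -
  interpret matroid M by (rule M)
  have "finite H" using H finite_ground by (rule finite_subset)
  then show ?thesis using H
  proof (induction H rule: finite_induct)
    case empty
    have "coloopify {} M = M"
      by (rule indep_system.equality) (use indep_subset_ground in \<open>auto simp: coloopify_def\<close>)
    then show ?case by (simp add: perturbation_def)
  next
    case (insert e H)
    have "e \<in> ground (coloopify H M)" using insert.prems by (simp add: coloopify_def)
    moreover have "matroid (coloopify H M)" by (rule matroid_coloopify[OF M])
    ultimately have "elementary_lift (coloopify H M) (coloopify {e} (coloopify H M))"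
      by (intro matroid.elementary_lift_coloopify)
    moreover have "coloopify {e} (coloopify H M) = coloopify (insert e H) M"
    proof -
      have "I - {e} - H = I - insert e H" for I :: "'a set" by auto
      then show ?thesis by (auto simp: coloopify_def)
    qed
    ultimately show ?case using insert unfolding perturbation_def by auto
  qed
qed

text \<open>If \<^term>\<open>B\<close> is a basis and \<^term>\<open>D\<close> a maximal independent subset of its complement, turning
  \<^term>\<open>D\<close> into loops makes the whole complement of \<^term>\<open>B\<close> loops and drops the rank by
  \<^term>\<open>card D\<close>, so \<^term>\<open>card D\<close> lifts then turn \<^term>\<open>B\<close> into coloops.\<close>

lemma disjoint_or_perturbation:
  assumes M: "matroid M"
  shows "(\<exists>N. perturbation k M N \<and> (\<forall>e\<in>ground N. loop N e \<or> coloop N e)) \<or>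
    (\<exists>D H K. D \<inter> H = {} \<and> H \<inter> K = {} \<and> D \<inter> K = {} \<and> D \<union> K \<in> indep M \<and> H \<union> K \<in> indep M
      \<and> card D = card H \<and> card D + card K = rank M (ground M) \<and> k < 2 * card D)"
proof -
  interpret matroid M by (rule M)
  obtain B where B: "B \<in> indep M" "card B = rank M (ground M)"
    using rank_witness[of "ground M"] by blast
  obtain D where D: "D \<in> indep M" "D \<subseteq> ground M - B" "card D = rank M (ground M - B)"
    using rank_witness[of "ground M - B"] by blast
  have BE: "B \<subseteq> ground M" by (rule indep_subset_ground[OF B(1)])
  have rBD: "rank M (B \<union> D) = card B"
    using rk.rank_mono[of B "B \<union> D"] rk.rank_mono[of "B \<union> D" "ground M"] B D(2) BE rank_indep[OF B(1)]
    by auto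
  \<comment> \<open>Basis exchange: \<open>D\<close> is completed by \<open>K\<close>, a part of
    \<open>B\<close>, and \<open>H\<close> is what \<open>D\<close> replaces. So \<open>D\<close>
    and \<open>H\<close> have equal size and are disjoint bases after contracting
    \<open>K\<close>.\<close>
  obtain J where J: "J \<in> indep M" "D \<subseteq> J" "J \<subseteq> B \<union> D" "card J = card B"
    using indep_extends[OF D(1), of "B \<union> D"] rBD by auto
  define K where "K = J - D"
  define H where "H = B - K"
  have KB: "K \<subseteq> B" and DK: "D \<union> K = J" "D \<inter> K = {}" and HK: "H \<union> K = B" "H \<inter> K = {}"
    using J(2,3) by (auto simp: K_def H_def)
  have DH: "D \<inter> H = {}" using D(2) by (auto simp: H_def)
  have fin: "finite J" "finite B" "finite D" "finite K" "finite H"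
    using finite_indep[OF J(1)] finite_indep[OF B(1)] finite_indep[OF D(1)]
    by (auto simp: K_def H_def)
  have cJ: "card D + card K = card B" using card_Un_disjoint[OF fin(3,4) DK(2)] DK(1) J(4) by simp
  have cB: "card H + card K = card B" using card_Un_disjoint[OF fin(5,4) HK(2)] HK(1) by simp
  show ?thesis
  proof (cases "k < 2 * card D")
    case True
    then have "D \<inter> H = {} \<and> H \<inter> K = {} \<and> D \<inter> K = {} \<and> D \<union> K \<in> indep M \<and> H \<union> K \<in> indep M
      \<and> card D = card H \<and> card D + card K = rank M (ground M) \<and> k < 2 * card D"
      using DH HK DK B J cJ cB by simp
    then show ?thesis by blast
  next
    case False
    define N where "N = coloopify H (loopify D M)"
    have N0: "matroid (loopify D M)" by (rule matroid_loopify[OF M D(1)])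
    have N: "matroid N" unfolding N_def by (rule matroid_coloopify[OF N0])
    have HE: "H \<subseteq> ground (loopify D M)" using BE by (auto simp: H_def loopify_def)
    have "perturbation (card D + card H) M N"
      unfolding N_def by (rule perturbation_trans[OF perturbation_loopify[OF M D(1)] perturbation_coloopify[OF N0 HE]])
    \<comment> \<open>The remaining steps are trivial projections.\<close>
    then have "perturbation (card D + card H + (k - 2 * card D)) M N"
      by (rule perturbation_trans[OF _ perturbation_refl[OF N]])
    moreover have "card D + card H + (k - 2 * card D) = k" using False cJ cB by linarith
    ultimately have pert: "perturbation k M N" by simp
    have gr: "ground N = ground M" by (simp add: N_def coloopify_def loopify_def)
    have indN: "I \<in> indep N \<longleftrightarrow> I \<subseteq> ground M \<and> (I - H) \<inter> D = {} \<and> (I - H) \<union> D \<in> indep M" for I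
      by (simp add: N_def coloopify_def loopify_def)
    have out: "{e} \<notin> indep N" if e: "e \<in> ground M - B" for e
    proof
      assume "{e} \<in> indep N"
      moreover have "{e} - H = {e}" using e by (auto simp: H_def)
      ultimately have "e \<notin> D" "insert e D \<in> indep M" by (auto simp: indN)
      then have "card (insert e D) \<le> card D"
        unfolding D(3) by (intro card_le_rank) (use e D(2) in auto)
      then show False using \<open>e \<notin> D\<close> fin(3) by simp
    qed
    have "B - H = K" using KB by (auto simp: H_def)
    then have BN: "B \<in> indep N" using indN[of B] BE DK J(1) by (auto simp: Un_commute Int_commute)
    \<comment> \<open>\<open>B\<close> contains every independent set of \<open>N\<close>, so it is
      the only basis and its elements are coloops.\<close>
    have sub: "I \<subseteq> B" if "I \<in> indep N" for I
    proof
      fix x assume x: "x \<in> I"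
      then have "{x} \<in> indep N" using matroid.indep_mono[OF N that, of "{x}"] by simp
      then show "x \<in> B" using out[of x] matroid.indep_subset_ground[OF N that] gr x by auto
    qed
    have "loop N e \<or> coloop N e" if e: "e \<in> ground N" for e
    proof (cases "e \<in> B")
      case True
      have "B' = B" if "basis N B'" for B'
        using that sub[of B'] BN BE gr by (auto simp: basis_def basis_in_def)
      then show ?thesis using True e by (auto simp: coloop_def)
    next
      case False
      then show ?thesis using out[of e] e gr by (auto simp: loop_def)
    qed
    then show ?thesis using pert by blast
  qed
qed

section \<open>Numerical estimates\<close>

lemma pow16_bound: "1 \<le> x \<Longrightarrow> 2 * x ^ 3 + 2 \<le> (16::nat) ^ x"
proof (induction x rule: nat_induct_at_least)
  case (Suc x)
  have "x \<le> x ^ 3" "x\<^sup>2 \<le> x ^ 3"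
    using Suc.hyps power_increasing[of 1 3 x] power_increasing[of 2 3 x] by auto
  have "2 * (Suc x) ^ 3 + 2 = 2 * x ^ 3 + 6 * x\<^sup>2 + 6 * x + 4"
    by (simp add: power3_eq_cube power2_eq_square algebra_simps)
  also have "\<dots> \<le> 16 * (2 * x ^ 3 + 2)"
  proof -
    \<comment> \<open>Variables replace the powers so that the inequality becomes linear.\<close>
    have "2 * c + 6 * q + 6 * p + 4 \<le> 16 * (2 * c + 2)" if "p \<le> c" "q \<le> c" for p q c :: nat
      using that by simp
    then show ?thesis by this (fact \<open>x \<le> x ^ 3\<close> \<open>x\<^sup>2 \<le> x ^ 3\<close>)+
  qed
  also have "\<dots> \<le> 16 ^ Suc x" using Suc.IH by simp
  finally show ?case .
qed simp

text \<open>Both factors of the product are at most \<open>4 ^ (s ^ 6)\<close>, so twice the left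
  side is at most \<open>4 ^ (2 * s ^ 6 + 1)\<close>. The exponents are compared by
  \<open>pow16_bound\<close> at \<open>s\<^sup>2\<close>, as
  \<open>4 ^ (2 * s\<^sup>2) = 16 ^ s\<^sup>2\<close>.\<close>

lemma size_bound:
  assumes s: "1 \<le> s" and a: "4 ^ 4 ^ (2 * s\<^sup>2) < 2 * a"
  shows "s ^ (s ^ 3) * 4 ^ (s ^ 3)\<^sup>2 + s ^ 3 \<le> (a::nat)"
proof -
  have lt: "n \<le> 4 ^ n" for n :: nat using power_gt_expt[of 4 n] by simp
  have "s ^ (s ^ 3) \<le> (4 ^ s) ^ (s ^ 3)" by (intro power_mono lt) simp
  also have "\<dots> = 4 ^ (s ^ 4)" by (simp add: power_mult[symmetric] power_Suc[symmetric] numeral_eq_Suc)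
  also have "\<dots> \<le> 4 ^ (s ^ 6)" using s by (intro power_increasing) auto
  finally have 1: "s ^ (s ^ 3) * 4 ^ (s ^ 3)\<^sup>2 \<le> 4 ^ (s ^ 6) * 4 ^ (s ^ 6)"
    by (simp add: power_mult[symmetric])
  have "s ^ 3 \<le> 4 ^ (s ^ 3)" by (rule lt)
  also have "\<dots> \<le> 4 ^ (2 * s ^ 6)"
    using s power_increasing[of 3 6 s] by (intro power_increasing) auto
  finally have "s ^ (s ^ 3) * 4 ^ (s ^ 3)\<^sup>2 + s ^ 3 \<le> 2 * 4 ^ (2 * s ^ 6)"
    using 1 by (simp add: power_add[symmetric] mult_2[symmetric])
  then have "2 * (s ^ (s ^ 3) * 4 ^ (s ^ 3)\<^sup>2 + s ^ 3) \<le> 4 ^ (2 * s ^ 6 + 1)" by simp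
  also have "\<dots> \<le> 4 ^ 4 ^ (2 * s\<^sup>2)"
  proof (rule power_increasing)
    have "2 * (s\<^sup>2) ^ 3 + 2 \<le> 16 ^ (s\<^sup>2)" by (rule pow16_bound) (use s in simp)
    then show "2 * s ^ 6 + 1 \<le> 4 ^ (2 * s\<^sup>2)" by (simp add: power_mult[symmetric] power_mult[of 4 2])
  qed simp
  finally have "2 * (s ^ (s ^ 3) * 4 ^ (s ^ 3)\<^sup>2 + s ^ 3) < 2 * a" using a by (rule le_less_trans)
  then show ?thesis unfolding mult_less_cancel1 by (blast intro: less_imp_le)
qed

theorem theorem1p4:
  fixes M :: "'a indep_system" and s k :: nat
  assumes "matroid M"
    and "k = 4 ^ (4 ^ (2 * s ^ 2))"
  shows "has_minor M (uniform s (2 * s))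
    \<or> has_minor M (direct_sum {..<s} (\<lambda>_. uniform 1 2))
    \<or> (\<exists>N. perturbation k M N \<and> (\<forall>e\<in>ground N. loop N e \<or> coloop N e))"
proof (cases "s = 0")
  interpret matroid M by (rule assms(1))
  case True
  \<comment> \<open>For \<open>s = 0\<close> the direct sum is empty and zero pairs suffice.\<close>
  have "parallel_pairs (rank M) {} {} id" by (simp add: parallel_pairs_def)
  then show ?thesis using has_parallel_pairs_minor[of "{}" "{}" id s] True by simp
next
  interpret matroid M by (rule assms(1))
  case False
  then have s: "1 \<le> s" by simp
  show ?thesis
  proof (cases "\<exists>N. perturbation k M N \<and> (\<forall>e\<in>ground N. loop N e \<or> coloop N e)")
    case False
    then obtain D H K where DHK: "D \<inter> H = {}" "H \<inter> K = {}" "D \<inter> K = {}" "D \<union> K \<in> indep M"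
      "H \<union> K \<in> indep M" "card D = card H" "card D + card K = rank M (ground M)" "k < 2 * card D"
      using disjoint_or_perturbation[OF assms(1), of k] by metis
    \<comment> \<open>Contracting \<open>K\<close> makes \<open>D\<close> and \<open>H\<close> two
      disjoint bases of \<open>D \<union> H\<close>.\<close>
    define r where "r X = rank M (X \<union> K) - rank M K" for X
    interpret r: rank_fun r unfolding r_def by (rule rk.rank_fun_contract)
    have fin: "finite D" "finite H" "finite K"
      using finite_indep[OF DHK(4)] finite_indep[OF DHK(5)] by auto
    have rK: "rank M K = card K" by (rule rank_indep) (use indep_mono[OF DHK(4)] in auto)
    have rD: "r D = card D"
      using rank_indep[OF DHK(4)] card_Un_disjoint[OF fin(1,3) DHK(3)] rK by (simp add: r_def)
    have rH: "r H = card D"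
      using rank_indep[OF DHK(5)] card_Un_disjoint[OF fin(2,3) DHK(2)] rK DHK(6) by (simp add: r_def)
    have "D \<union> H \<union> K \<subseteq> ground M" using indep_subset_ground DHK(4,5) by blast
    then have "r (D \<union> H) \<le> card D" using rk.rank_mono[of "D \<union> H \<union> K" "ground M"] DHK(7) rK by (simp add: r_def)
    then have top: "r (D \<union> H) = card D" using r.rank_mono[of D "D \<union> H"] rD by simp
    have "s ^ (s ^ 3) * 4 ^ (s ^ 3)\<^sup>2 + s ^ 3 \<le> card D"
      using size_bound[OF s] DHK(8) assms(2) by simp
    then have "(\<exists>C Q \<sigma>. parallel_pairs r C Q \<sigma> \<and> card Q = s) \<or> (\<exists>C X. uniform_over r s C X)"
      by (rule r.parallel_pairs_or_uniform[OF fin(1) rD fin(2) DHK(1) rH DHK(6)[symmetric] top s])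
    then show ?thesis
    proof (elim disjE exE conjE)
      fix C Q \<sigma> assume "parallel_pairs r C Q \<sigma>" "card Q = s"
      then have "parallel_pairs (rank M) (C \<union> K) Q \<sigma>"
        unfolding r_def[abs_def] by (intro rk.parallel_pairs_contract)
      then show ?thesis using has_parallel_pairs_minor[OF _ \<open>card Q = s\<close>] by blast
    next
      fix C X assume "uniform_over r s C X"
      then have "uniform_over (rank M) s (C \<union> K) X"
        unfolding r_def[abs_def] by (intro rk.uniform_over_contract)
      then show ?thesis using has_uniform_minor[OF s] by blast
    qed
  qed simp
qed

end
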